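(* Let $k\ge 3$ be an integer and let $P$ be a set of $k$ points in general position on the unit sphere $\mathbb{S}^2\subset\mathbb{R}^3$. Let $\mathcal S$ be obtained from $P$ by adding, for each $p\in P$, its antipodal point $\bar p$, so $|\mathcal S|=n=2k$. Suppose each pair $\{p,\bar p\}$ ($p\in P$) is joined by a half-circle in such a way that no two of these $k$ half-circles cross each other. Let $\widehat D_n$ be the geodesic drawing on $\mathbb{S}^2$ obtained by joining any two points of $\mathcal S$ that are not in the same antipodal pair by a geodesic arc, together with the $k$ chosen half-circles joining the antipodal pairs. Then $\widehat D_n$ is a geodesic drawing of the complete graph $K_n$ with exactly $H(n)$ crossings. Moreover: (i) by deleting any one point of $\mathcal S$ (together with all edges incident with it), one obtains a drawing of $K_{n-1}$ with exactly $H(n-1)$ crossings; (ii) by adding any new point $q\in\mathbb{S}^2$ (in general position with respect to $\mathcal S$) and joining $q$ by geodesic arcs to all points of $\mathcal S$, one obtains a geodesic drawing of $K_{n+1}$ with exactly $H(n+1)$ crossings.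
   Context: For points $p,q\in\mathbb{S}^2$, a geodesic arc (geodesic) joining them is the shorter of the two segments from $p$ to $q$ on a great circle through $p$ and $q$ (unique unless $q=\bar p$ is antipodal to $p$). A geodesic arc joining two antipodal points is half of a great circle and is called a half-circle. A geodesic drawing of a graph on $\mathbb{S}^2$ places vertices at distinct points and draws every edge as a geodesic arc between its endpoints. A set of points in $\mathbb{S}^2$ is in general position if no three of its points lie on a common great circle. The number of crossings of a drawing counts the crossings between pairs of edges (points where two edges meet in their interiors). For an integer $n$, $H(n)=\tfrac14\lfloor \tfrac n2\rfloor\lfloor \tfrac{n-1}2\rfloor\lfloor \tfrac{n-2}2\rfloor\lfloor \tfrac{n-3}2\rfloor$, which equals $\tfrac1{64}n(n-2)^2(n-4)$ for $n$ even and $\tfrac1{64}(n-1)^2(n-3)^2$ for $n$ odd.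
   Formalization: The half-circles are assumed to contain no other points of S, and q to lie on no chosen half-circle (else edges overlap in an arc); general position of q means no great circle contains q and two non-antipodal points of S. *)

theory Defs
  imports "HOL-Analysis.Analysis"
begin

definition great_circle :: "(real^3) set \<Rightarrow> bool" where
  "great_circle C \<longleftrightarrow> (\<exists>W. subspace W \<and> dim W = 2 \<and> C = sphere 0 1 \<inter> W)"

definition general_position :: "(real^3) set \<Rightarrow> bool" where
  "general_position P \<longleftrightarrow>
     (\<forall>x\<in>P. \<forall>y\<in>P. \<forall>z\<in>P. x \<noteq> y \<and> x \<noteq> z \<and> y \<noteq> z \<longrightarrow>
        \<not> (\<exists>C. great_circle C \<and> {x, y, z} \<subseteq> C))"

(* Arcs are point sets.  For orthonormal a, b the curve t \<mapsto> cos t a + sin t b traverses a great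
   circle at unit speed, so \<theta> is the length of the segment from p to q and 2 * pi - \<theta> the length
   of the complementary segment. *)
definition geodesic_arc :: "real^3 \<Rightarrow> real^3 \<Rightarrow> (real^3) set \<Rightarrow> bool" where
  "geodesic_arc p q A \<longleftrightarrow>
     (\<exists>a b \<theta>. norm a = 1 \<and> norm b = 1 \<and> a \<bullet> b = 0 \<and> 0 < \<theta> \<and> \<theta> \<le> 2 * pi - \<theta> \<and>
        p = a \<and> q = cos \<theta> *\<^sub>R a + sin \<theta> *\<^sub>R b \<and>
        A = (\<lambda>t. cos t *\<^sub>R a + sin t *\<^sub>R b) ` {0..\<theta>})"

abbreviation half_circle :: "real^3 \<Rightarrow> (real^3) set \<Rightarrow> bool" where
  "half_circle p A \<equiv> geodesic_arc p (- p) A"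

(* Vertices are identified with the points at which they are placed, an edge is a two-element set
   of points, and D assigns to every edge the point set that draws it.  The last conjunct is the
   usual convention that an edge meets no vertices other than its endpoints. *)
definition geodesic_drawing ::
  "(real^3) set \<Rightarrow> (real^3) set set \<Rightarrow> ((real^3) set \<Rightarrow> (real^3) set) \<Rightarrow> bool" where
  "geodesic_drawing V E D \<longleftrightarrow>
     V \<subseteq> sphere 0 1 \<and>
     (\<forall>e\<in>E. \<exists>u\<in>V. \<exists>v\<in>V. u \<noteq> v \<and> e = {u, v} \<and> geodesic_arc u v (D e)) \<and>
     (\<forall>e\<in>E. D e \<inter> V = e)"

definition complete_edges :: "'a set \<Rightarrow> 'a set set" where
  "complete_edges V = {e. e \<subseteq> V \<and> card e = 2}"

definition geodesic_drawing_of_complete_graph ::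
  "nat \<Rightarrow> (real^3) set \<Rightarrow> ((real^3) set \<Rightarrow> (real^3) set) \<Rightarrow> bool" where
  "geodesic_drawing_of_complete_graph n V D \<longleftrightarrow>
     finite V \<and> card V = n \<and> geodesic_drawing V (complete_edges V) D"

(* A crossing is an unordered pair of distinct edges with a common interior point.  If several
   edges pass through one point, every pair of them counts. *)
definition crossings ::
  "(real^3) set set \<Rightarrow> ((real^3) set \<Rightarrow> (real^3) set) \<Rightarrow> ((real^3) set set \<times> (real^3)) set" where
  "crossings E D =
     {({e, f}, x) | e f x. e \<in> E \<and> f \<in> E \<and> e \<noteq> f \<and> x \<in> D e - e \<and> x \<in> D f - f}"

definition has_exactly_crossings ::
  "(real^3) set \<Rightarrow> ((real^3) set \<Rightarrow> (real^3) set) \<Rightarrow> real \<Rightarrow> bool" where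
  "has_exactly_crossings V D c \<longleftrightarrow>
     finite (crossings (complete_edges V) D) \<and>
     real (card (crossings (complete_edges V) D)) = c"

definition H :: "int \<Rightarrow> real" where
  "H n = 1/4 * of_int (\<lfloor>of_int n / 2 :: real\<rfloor> * \<lfloor>(of_int n - 1) / 2 :: real\<rfloor> *
                       \<lfloor>(of_int n - 2) / 2 :: real\<rfloor> * \<lfloor>(of_int n - 3) / 2 :: real\<rfloor>)"

definition antipodal_pairs :: "(real^3) set \<Rightarrow> (real^3) set set" where
  "antipodal_pairs P = {{p, - p} | p. p \<in> P}"

(* The arcs of the drawing: the chosen half-circle h e for an antipodal pair e, and otherwise the
   geodesic arc joining the two points of e, which is unique since they are not antipodal. *)
definition antipodal_drawing ::
  "(real^3) set \<Rightarrow> ((real^3) set \<Rightarrow> (real^3) set) \<Rightarrow> (real^3) set \<Rightarrow> (real^3) set" where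
  "antipodal_drawing P h e =
     (if e \<in> antipodal_pairs P then h e
      else (THE A. \<exists>u v. e = {u, v} \<and> geodesic_arc u v A))"

(* Points u, - u lie on a great circle together with any third point, so for a set S that contains
   antipodal pairs only the great circles through non-antipodal points of S are to be avoided. *)
definition general_position_wrt :: "real^3 \<Rightarrow> (real^3) set \<Rightarrow> bool" where
  "general_position_wrt q S \<longleftrightarrow>
     (\<forall>u\<in>S. \<forall>v\<in>S. u \<noteq> v \<and> v \<noteq> - u \<longrightarrow>
        \<not> (\<exists>C. great_circle C \<and> {q, u, v} \<subseteq> C))"

end

theory Submission
  imports Defs
begin

text \<open>
  A geodesic arc is the intersection of the sphere with a planar sector, and a half-circle is the
  intersection with a closed half-plane, so all crossings are decided by signs of coordinates.

  Fix a vertex \<open>q\<close> and let \<open>m\<close> be the number of antipodal pairs not containing it.  For points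
  \<open>a\<close>, \<open>b\<close>, \<open>c\<close> of different pairs, expanding \<open>q\<close> in the basis \<open>a\<close>, \<open>b\<close>, \<open>c\<close> shows that exactly one
  choice of signs makes the arc from \<open>q\<close> to \<open>\<plusminus>a\<close> cross the arc from \<open>\<plusminus>b\<close> to \<open>\<plusminus>c\<close>; this gives
  \<open>m (m - 1 choose 2)\<close> crossings at \<open>q\<close>.  Because the half-circles at \<open>b\<close> and \<open>c\<close> do not cross,
  exactly one of them meets the two arcs from \<open>q\<close> to the other pair, and it meets only one of these
  arcs: \<open>m choose 2\<close> more.  If \<open>- q\<close> is a vertex, the half-circle at \<open>q\<close> crosses exactly one of the
  four arcs from \<open>\<plusminus>b\<close> to \<open>\<plusminus>c\<close>, which gives another \<open>m choose 2\<close>.  Hence the number of crossings at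
  \<open>q\<close> is known both for a point of \<open>S\<close> and for an added point; as every crossing involves four
  vertices, the total follows by double counting.
\<close>

subsection \<open>Linear independence and arcs\<close>

text \<open>Independence of a list of vectors rather than of a set: a repeated vector makes it fail,
  and the quantified coefficients can be instantiated and compared directly.\<close>

definition indep2 :: "real^3 \<Rightarrow> real^3 \<Rightarrow> bool" where
  "indep2 u v \<longleftrightarrow> (\<forall>\<alpha> \<beta>. \<alpha> *\<^sub>R u + \<beta> *\<^sub>R v = 0 \<longrightarrow> \<alpha> = 0 \<and> \<beta> = 0)"

definition indep3 :: "real^3 \<Rightarrow> real^3 \<Rightarrow> real^3 \<Rightarrow> bool" where
  "indep3 u v w \<longleftrightarrow>
     (\<forall>\<alpha> \<beta> \<gamma>. \<alpha> *\<^sub>R u + \<beta> *\<^sub>R v + \<gamma> *\<^sub>R w = 0 \<longrightarrow> \<alpha> = 0 \<and> \<beta> = 0 \<and> \<gamma> = 0)"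

lemma indep3_eqD:
  assumes "indep3 u v w"
    and "\<alpha> *\<^sub>R u + \<beta> *\<^sub>R v + \<gamma> *\<^sub>R w = \<alpha>' *\<^sub>R u + \<beta>' *\<^sub>R v + \<gamma>' *\<^sub>R w"
  shows "\<alpha> = \<alpha>'" "\<beta> = \<beta>'" "\<gamma> = \<gamma>'"
proof -
  have "(\<alpha> - \<alpha>') *\<^sub>R u + (\<beta> - \<beta>') *\<^sub>R v + (\<gamma> - \<gamma>') *\<^sub>R w = 0"
    using assms(2) by (simp add: algebra_simps)
  then have "\<alpha> - \<alpha>' = 0 \<and> \<beta> - \<beta>' = 0 \<and> \<gamma> - \<gamma>' = 0"
    using assms(1) unfolding indep3_def by blast
  then show "\<alpha> = \<alpha>'" "\<beta> = \<beta>'" "\<gamma> = \<gamma>'" by auto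
qed

text \<open>The three vectors are distinct, so they form an independent set of size 3 and their span
  has full dimension.\<close>

lemma indep3_coords:
  assumes "indep3 u v w"
  obtains \<alpha> \<beta> \<gamma> where "x = \<alpha> *\<^sub>R u + \<beta> *\<^sub>R v + \<gamma> *\<^sub>R w"
proof -
  note D = assms[unfolded indep3_def, rule_format]
  have ne: "u \<noteq> v" "u \<noteq> w" "v \<noteq> w"
    using D[of 1 "-1" 0] D[of 1 0 "-1"] D[of 0 1 "-1"] by auto
  have "independent {u, v, w}"
    unfolding independent_explicit
  proof (intro allI impI conjI)
    fix c assume "(\<Sum>x\<in>{u, v, w}. c x *\<^sub>R x) = 0"
    then have "c u *\<^sub>R u + c v *\<^sub>R v + c w *\<^sub>R w = 0"
      using ne by (simp add: algebra_simps)
    then show "\<forall>x\<in>{u, v, w}. c x = 0"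
      using D by blast
  qed simp
  moreover have "card {u, v, w} = 3" using ne by simp
  ultimately have "dim {u, v, w} = 3"
    by (metis dim_eq_card_independent)
  then have "span {u, v, w} = UNIV"
    by (simp add: dim_eq_full[symmetric])
  then have "x \<in> span {u, v, w}" by simp
  then obtain \<alpha> \<beta> \<gamma> where "x - \<alpha> *\<^sub>R u - \<beta> *\<^sub>R v = \<gamma> *\<^sub>R w"
    unfolding span_breakdown_eq by auto
  then show thesis using that[of \<alpha> \<beta> \<gamma>] by (simp add: algebra_simps)
qed

text \<open>A nontrivial relation places the three points in the span of two vectors; a plane
  containing this span cuts the sphere in a great circle through all three.\<close>

lemma indep3_if_not_great_circle:
  assumes "norm u = 1" "norm v = 1" "norm w = 1"
    and ng: "\<not> (\<exists>C. great_circle C \<and> {u, v, w} \<subseteq> C)"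
  shows "indep3 u v w"
proof (rule ccontr)
  assume "\<not> indep3 u v w"
  then obtain \<alpha> \<beta> \<gamma> where eq: "\<alpha> *\<^sub>R u + \<beta> *\<^sub>R v + \<gamma> *\<^sub>R w = 0"
    and nz: "\<alpha> \<noteq> 0 \<or> \<beta> \<noteq> 0 \<or> \<gamma> \<noteq> 0"
    unfolding indep3_def by blast
  have span2: "\<exists>x y. {u, v, w} \<subseteq> span {x, y}"
    using nz
  proof (elim disjE)
    assume "\<alpha> \<noteq> 0"
    have "u = (-\<beta>/\<alpha>) *\<^sub>R v + (-\<gamma>/\<alpha>) *\<^sub>R w"
    proof -
      have "\<alpha> *\<^sub>R u = \<alpha> *\<^sub>R ((-\<beta>/\<alpha>) *\<^sub>R v + (-\<gamma>/\<alpha>) *\<^sub>R w)"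
        using eq \<open>\<alpha> \<noteq> 0\<close> by (simp add: algebra_simps eq_neg_iff_add_eq_0)
      then show ?thesis using \<open>\<alpha> \<noteq> 0\<close> by (metis scaleR_cancel_left)
    qed
    then have "u \<in> span {v, w}"
      by (metis span_add span_scale span_base insertI1 insertI2)
    then show ?thesis by (intro exI[of _ v] exI[of _ w]) (auto simp: span_base)
  next
    assume "\<beta> \<noteq> 0"
    have "v = (-\<alpha>/\<beta>) *\<^sub>R u + (-\<gamma>/\<beta>) *\<^sub>R w"
    proof -
      have "\<beta> *\<^sub>R v = \<beta> *\<^sub>R ((-\<alpha>/\<beta>) *\<^sub>R u + (-\<gamma>/\<beta>) *\<^sub>R w)"
        using eq \<open>\<beta> \<noteq> 0\<close> by (simp add: algebra_simps eq_neg_iff_add_eq_0)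
      then show ?thesis using \<open>\<beta> \<noteq> 0\<close> by (metis scaleR_cancel_left)
    qed
    then have "v \<in> span {u, w}"
      by (metis span_add span_scale span_base insertI1 insertI2)
    then show ?thesis by (intro exI[of _ u] exI[of _ w]) (auto simp: span_base)
  next
    assume "\<gamma> \<noteq> 0"
    have "w = (-\<alpha>/\<gamma>) *\<^sub>R u + (-\<beta>/\<gamma>) *\<^sub>R v"
    proof -
      have "\<gamma> *\<^sub>R w = \<gamma> *\<^sub>R ((-\<alpha>/\<gamma>) *\<^sub>R u + (-\<beta>/\<gamma>) *\<^sub>R v)"
        using eq \<open>\<gamma> \<noteq> 0\<close> by (simp add: algebra_simps eq_neg_iff_add_eq_0)
      then show ?thesis using \<open>\<gamma> \<noteq> 0\<close> by (metis scaleR_cancel_left)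
    qed
    then have "w \<in> span {u, v}"
      by (metis span_add span_scale span_base insertI1 insertI2)
    then show ?thesis by (intro exI[of _ u] exI[of _ v]) (auto simp: span_base)
  qed
  then obtain x y where xy: "{u, v, w} \<subseteq> span {x, y}" by blast
  \<comment> \<open>The span of x and y may have dimension below 2, so the plane is taken as the
    hyperplane orthogonal to a normal vector n, whose dimension is exactly 2.\<close>
  have "dim {x, y} \<le> card {x, y}" by (rule dim_le_card') simp
  also have "\<dots> \<le> 2" by (simp add: card_insert_if)
  finally have "dim {x, y} < DIM(real^3)" by simp
  then obtain n where n: "n \<noteq> 0" "\<And>z. z \<in> span {x, y} \<Longrightarrow> orthogonal n z"
    using orthogonal_to_subspace_exists by blast
  have "great_circle (sphere 0 1 \<inter> {z. n \<bullet> z = 0})"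
    unfolding great_circle_def
    using n(1) dim_hyperplane[of n] by (intro exI[of _ "{z. n \<bullet> z = 0}"]) (auto simp: subspace_hyperplane)
  moreover have "{u, v, w} \<subseteq> sphere 0 1 \<inter> {z. n \<bullet> z = 0}"
    using assms(1-3) n(2) xy by (auto simp: orthogonal_def)
  ultimately show False using ng by blast
qed

text \<open>Taking norms in a relation forces \<alpha> and \<beta> to agree up to sign, so a
  nontrivial relation would make v equal to u or - u.\<close>

lemma indep2_unit:
  assumes "norm u = 1" "norm v = 1" "v \<noteq> u" "v \<noteq> - u"
  shows "indep2 u v"
  unfolding indep2_def
proof (intro allI impI)
  fix \<alpha> \<beta> assume eq: "\<alpha> *\<^sub>R u + \<beta> *\<^sub>R v = 0"
  then have e: "\<alpha> *\<^sub>R u = (- \<beta>) *\<^sub>R v" by (simp add: eq_neg_iff_add_eq_0)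
  then have "norm (\<alpha> *\<^sub>R u) = norm ((- \<beta>) *\<^sub>R v)" by (rule arg_cong)
  then have "\<bar>\<alpha>\<bar> = \<bar>\<beta>\<bar>" using assms by simp
  then have "\<alpha> = \<beta> \<or> \<alpha> = - \<beta>" by linarith
  then show "\<alpha> = 0 \<and> \<beta> = 0"
  proof
    assume a: "\<alpha> = \<beta>"
    have "\<alpha> *\<^sub>R (u + v) = 0" using eq a by (simp add: scaleR_add_right)
    moreover have "u + v \<noteq> 0" using assms(4) by (metis add.inverse_unique)
    ultimately show ?thesis using a by simp
  next
    assume a: "\<alpha> = - \<beta>"
    have "\<alpha> *\<^sub>R u = \<alpha> *\<^sub>R v" using e a by simp
    then show ?thesis using a assms(3) by auto
  qed
qed

lemma indep2_orthonormal:
  assumes "norm a = 1" "norm b = 1" "a \<bullet> b = 0"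
  shows "indep2 a b"
proof (rule indep2_unit[OF assms(1,2)])
  have "a \<bullet> a = 1" using assms(1) by (simp add: norm_eq_1)
  then show "b \<noteq> a" "b \<noteq> - a" using assms(3) by auto
qed

lemma orthonormal_norm_eq:
  fixes a b :: "'a::real_inner"
  assumes "norm a = 1" "norm b = 1" "a \<bullet> b = 0"
  shows "norm (s *\<^sub>R a + t *\<^sub>R b) = 1 \<longleftrightarrow> s\<^sup>2 + t\<^sup>2 = 1"
proof -
  have "a \<bullet> a = 1" "b \<bullet> b = 1" "b \<bullet> a = 0"
    using assms by (simp_all add: norm_eq_1 inner_commute)
  then show ?thesis using assms(3)
    by (simp add: norm_eq_1 inner_simps power2_eq_square)
qed

text \<open>The parameter is \<open>arccos s\<close>: its sine is the nonnegative root of 1 - s^2,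
  which equals r because r is nonnegative.\<close>

lemma half_turn_range:
  assumes "norm a = 1" "norm b = 1" "a \<bullet> b = 0"
    and "norm (s *\<^sub>R a + r *\<^sub>R b) = 1" "0 \<le> r"
  obtains t where "0 \<le> t" "t \<le> pi" "cos t = s" "sin t = r"
proof
  have sq: "s\<^sup>2 + r\<^sup>2 = 1" using assms orthonormal_norm_eq by blast
  then have "s\<^sup>2 \<le> 1" by (smt (verit) zero_le_power2)
  then have s: "-1 \<le> s" "s \<le> 1"
    by (auto simp: abs_square_le_1)
  show "0 \<le> arccos s" "arccos s \<le> pi" "cos (arccos s) = s"
    using s by (auto simp: arccos_lbound arccos_ubound)
  have "sin (arccos s) = sqrt (1 - s\<^sup>2)" using s by (simp add: sin_arccos)
  also have "1 - s\<^sup>2 = r\<^sup>2" using sq by simp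
  finally show "sin (arccos s) = r" using assms(5) by simp
qed

section \<open>Arcs as intersections of the sphere with planar cones\<close>

definition closed_sector :: "real^3 \<Rightarrow> real^3 \<Rightarrow> (real^3) set" where
  "closed_sector u v = {s *\<^sub>R u + t *\<^sub>R v | s t. 0 \<le> s \<and> 0 \<le> t}"

definition closed_half_plane :: "real^3 \<Rightarrow> real^3 \<Rightarrow> (real^3) set" where
  "closed_half_plane u d = {s *\<^sub>R u + t *\<^sub>R d | s t. 0 \<le> t}"

lemma closed_sector_commute: "closed_sector u v = closed_sector v u"
  unfolding closed_sector_def by (auto; metis add.commute)

text \<open>Since v is not antipodal to u, the angle \<theta> is below pi and sin \<theta> is
  positive. Coordinates can therefore be changed between the orthonormal frame of the arc and the
  basis u, v with control over signs.\<close>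

lemma geodesic_arc_eq_cone:
  assumes "geodesic_arc u v A" "v \<noteq> - u"
  shows "A = sphere 0 1 \<inter> closed_sector u v"
proof -
  obtain b \<theta> where on: "norm u = 1" "norm b = 1" "u \<bullet> b = 0" and \<theta>: "0 < \<theta>" "\<theta> \<le> pi"
    and v: "v = cos \<theta> *\<^sub>R u + sin \<theta> *\<^sub>R b"
    and A: "A = (\<lambda>t. cos t *\<^sub>R u + sin t *\<^sub>R b) ` {0..\<theta>}"
    using assms(1) unfolding geodesic_arc_def by auto
  have "\<theta> \<noteq> pi" using v assms(2) by auto
  then have \<theta>': "\<theta> < pi" using \<theta> by simp
  have s0: "sin \<theta> > 0" using \<theta> \<theta>' by (simp add: sin_gt_zero)
  have "cos t *\<^sub>R u + sin t *\<^sub>R b \<in> sphere 0 1 \<inter> closed_sector u v" if "0 \<le> t" "t \<le> \<theta>" for t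
  proof -
    \<comment> \<open>The coefficients of spherical linear interpolation; both sines are nonnegative
      for t between 0 and \<theta>.\<close>
    have eq: "cos t *\<^sub>R u + sin t *\<^sub>R b = (sin (\<theta> - t) / sin \<theta>) *\<^sub>R u + (sin t / sin \<theta>) *\<^sub>R v"
    proof -
      have c: "sin (\<theta> - t) / sin \<theta> + sin t / sin \<theta> * cos \<theta> = cos t"
        using s0 by (simp add: sin_diff field_simps)
      have "(sin (\<theta> - t) / sin \<theta>) *\<^sub>R u + (sin t / sin \<theta>) *\<^sub>R v
          = (sin (\<theta> - t) / sin \<theta> + sin t / sin \<theta> * cos \<theta>) *\<^sub>R u + sin t *\<^sub>R b"
        using s0 by (simp add: v scaleR_add_right scaleR_add_left)
      then show ?thesis using c by simp
    qed
    have "sin (\<theta> - t) \<ge> 0" "sin t \<ge> 0" using that \<theta> by (auto intro!: sin_ge_zero)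
    moreover have "norm (cos t *\<^sub>R u + sin t *\<^sub>R b) = 1"
      using orthonormal_norm_eq[OF on] by simp
    ultimately show ?thesis
      using s0 unfolding closed_sector_def eq
      by simp (intro exI[of _ "sin (\<theta> - t) / sin \<theta>"] exI[of _ "sin t / sin \<theta>"], simp)
  qed
  moreover have "x \<in> A" if x: "x \<in> sphere 0 1 \<inter> closed_sector u v" for x
  proof -
    obtain s r where sr: "0 \<le> s" "0 \<le> r" and xe: "x = s *\<^sub>R u + r *\<^sub>R v" and nx: "norm x = 1"
      using x by (auto simp: closed_sector_def)
    have xe': "x = (s + r * cos \<theta>) *\<^sub>R u + (r * sin \<theta>) *\<^sub>R b"
      unfolding xe v by (simp add: algebra_simps)
    have "0 \<le> r * sin \<theta>" using sr s0 by simp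
    then obtain t where t: "0 \<le> t" "t \<le> pi" "cos t = s + r * cos \<theta>" "sin t = r * sin \<theta>"
      using half_turn_range[OF on] nx unfolding xe' by blast
    \<comment> \<open>The parameter cannot pass v: beyond \<theta> the sine of t - \<theta> would be
      positive, but it equals - s sin \<theta>, which is at most 0.\<close>
    have "t \<le> \<theta>"
    proof (rule ccontr)
      assume "\<not> t \<le> \<theta>"
      then have "sin (t - \<theta>) > 0" using t \<theta> by (intro sin_gt_zero) auto
      moreover have "sin (t - \<theta>) = - (s * sin \<theta>)"
        unfolding sin_diff t(3,4) by (simp add: algebra_simps)
      ultimately show False using sr s0 by (simp add: mult_less_0_iff)
    qed
    then show ?thesis using t xe' unfolding A by (auto intro!: image_eqI[of _ _ t])
  qed
  ultimately show ?thesis unfolding A by auto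
qed

text \<open>Ending at - u forces sin \<theta> = 0, hence \<theta> = pi; over a half turn the sine
  takes just the nonnegative values, which describes a half-plane. The vector d is the midpoint of
  the half-circle.\<close>

lemma half_circle_eq_half_plane:
  assumes "half_circle u A"
  obtains d where "norm d = 1" "u \<bullet> d = 0" "A = sphere 0 1 \<inter> closed_half_plane u d"
proof -
  obtain b \<theta> where on: "norm u = 1" "norm b = 1" "u \<bullet> b = 0" and \<theta>: "0 < \<theta>" "\<theta> \<le> pi"
    and v: "- u = cos \<theta> *\<^sub>R u + sin \<theta> *\<^sub>R b"
    and A: "A = (\<lambda>t. cos t *\<^sub>R u + sin t *\<^sub>R b) ` {0..\<theta>}"
    using assms unfolding geodesic_arc_def by auto
  have "(1 + cos \<theta>) *\<^sub>R u + sin \<theta> *\<^sub>R b = u + (cos \<theta> *\<^sub>R u + sin \<theta> *\<^sub>R b)"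
    by (simp add: scaleR_add_left)
  also have "\<dots> = 0" by (simp flip: v)
  finally have "sin \<theta> = 0"
    using indep2_orthonormal[OF on] unfolding indep2_def by blast
  then have "\<theta> = pi" using \<theta> sin_gt_zero by force
  have "A = sphere 0 1 \<inter> closed_half_plane u b"
  proof (intro equalityI subsetI)
    fix x assume "x \<in> A"
    then obtain t where t: "0 \<le> t" "t \<le> pi" "x = cos t *\<^sub>R u + sin t *\<^sub>R b"
      unfolding A \<open>\<theta> = pi\<close> by auto
    then show "x \<in> sphere 0 1 \<inter> closed_half_plane u b"
      using orthonormal_norm_eq[OF on] sin_ge_zero[of t] by (auto simp: closed_half_plane_def)
  next
    fix x assume "x \<in> sphere 0 1 \<inter> closed_half_plane u b"
    then obtain s r where x: "x = s *\<^sub>R u + r *\<^sub>R b" "0 \<le> r" "norm x = 1"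
      by (auto simp: closed_half_plane_def)
    then obtain t where "0 \<le> t" "t \<le> pi" "cos t = s" "sin t = r"
      using half_turn_range[OF on] by blast
    then show "x \<in> A" unfolding A \<open>\<theta> = pi\<close> x(1) by (auto intro!: image_eqI[of _ _ t])
  qed
  then show thesis using that on by blast
qed

text \<open>Gram-Schmidt: the initial direction is the normalised component w of v orthogonal to u,
  and the length is the arccosine of the inner product of u and v.\<close>

lemma geodesic_arc_exists:
  assumes "norm u = 1" "norm v = 1" "v \<noteq> u" "v \<noteq> - u"
  shows "\<exists>A. geodesic_arc u v A"
proof -
  define c where "c = u \<bullet> v"
  define w where "w = v - c *\<^sub>R u"
  have uu: "u \<bullet> u = 1" "v \<bullet> v = 1" using assms by (simp_all add: norm_eq_1)
  have "w \<noteq> 0"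
  proof
    assume "w = 0"
    then have "(- c) *\<^sub>R u + 1 *\<^sub>R v = 0" by (simp add: w_def)
    then show False using indep2_unit[OF assms] unfolding indep2_def by fastforce
  qed
  then have "w \<bullet> w > 0" by simp
  moreover have ww: "w \<bullet> w = 1 - c\<^sup>2"
    unfolding w_def using uu by (simp add: inner_simps inner_commute c_def power2_eq_square)
  ultimately have c1: "c\<^sup>2 < 1" by simp
  then have c: "-1 < c" "c < 1"
    using abs_square_less_1[of c] by auto
  have nw: "norm w = sqrt (1 - c\<^sup>2)" using ww by (simp add: norm_eq_sqrt_inner)
  have uw: "u \<bullet> w = 0" unfolding w_def using uu by (simp add: inner_simps c_def)
  have "sin (arccos c) = sqrt (1 - c\<^sup>2)" using c by (simp add: sin_arccos)
  moreover have "sqrt (1 - c\<^sup>2) \<noteq> 0" using c1 by simp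
  ultimately have v: "v = cos (arccos c) *\<^sub>R u + sin (arccos c) *\<^sub>R (w /\<^sub>R norm w)"
    using c by (simp add: nw) (simp add: w_def)
  have "0 < arccos c" "arccos c < pi" using arccos_lt_bounded c by auto
  then show ?thesis unfolding geodesic_arc_def
    using v assms(1) \<open>w \<noteq> 0\<close> uw
    by (intro exI[of _ u] exI[of _ "w /\<^sub>R norm w"] exI[of _ "arccos c"] exI) auto
qed

definition open_sector :: "real^3 \<Rightarrow> real^3 \<Rightarrow> (real^3) set" where
  "open_sector u v = {s *\<^sub>R u + t *\<^sub>R v | s t. 0 < s \<and> 0 < t}"

definition open_half_plane :: "real^3 \<Rightarrow> real^3 \<Rightarrow> (real^3) set" where
  "open_half_plane u d = {s *\<^sub>R u + t *\<^sub>R d | s t. 0 < t}"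

text \<open>Each boundary ray of the sector meets the sphere in one point, u or v, and by
  independence neither of these lies in the open sector.\<close>

lemma arc_interior:
  assumes "norm u = 1" "norm v = 1" "v \<noteq> u" "v \<noteq> - u"
  shows "sphere 0 1 \<inter> closed_sector u v - {u, v} = sphere 0 1 \<inter> open_sector u v"
proof (intro equalityI subsetI)
  fix x assume "x \<in> sphere 0 1 \<inter> closed_sector u v - {u, v}"
  then obtain s t where x: "x = s *\<^sub>R u + t *\<^sub>R v" "0 \<le> s" "0 \<le> t" "norm x = 1" "x \<noteq> u" "x \<noteq> v"
    by (auto simp: closed_sector_def)
  have "s \<noteq> 0"
  proof
    assume "s = 0" then have "t = 1" using x assms by simp
    then show False using \<open>s = 0\<close> x by simp
  qed
  moreover have "t \<noteq> 0"
  proof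
    assume "t = 0" then have "s = 1" using x assms by simp
    then show False using \<open>t = 0\<close> x by simp
  qed
  ultimately have "0 < s" "0 < t" using x by auto
  then show "x \<in> sphere 0 1 \<inter> open_sector u v" using x by (auto simp: open_sector_def)
next
  fix x assume "x \<in> sphere 0 1 \<inter> open_sector u v"
  then obtain s t where x: "x = s *\<^sub>R u + t *\<^sub>R v" "0 < s" "0 < t" "norm x = 1"
    by (auto simp: open_sector_def)
  note D = indep2_unit[OF assms, unfolded indep2_def, rule_format]
  have "x \<noteq> u"
  proof
    assume "x = u" then have "(s - 1) *\<^sub>R u + t *\<^sub>R v = 0" using x by (simp add: algebra_simps)
    then show False using D x by blast
  qed
  moreover have "x \<noteq> v"
  proof
    assume "x = v" then have "s *\<^sub>R u + (t - 1) *\<^sub>R v = 0" using x by (simp add: algebra_simps)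
    then show False using D x by blast
  qed
  ultimately show "x \<in> sphere 0 1 \<inter> closed_sector u v - {u, v}"
    using x by (force simp: closed_sector_def)
qed

text \<open>The boundary line of the half-plane meets the sphere exactly in u and - u.\<close>

lemma half_circle_interior:
  assumes "norm u = 1" "norm d = 1" "u \<bullet> d = 0"
  shows "sphere 0 1 \<inter> closed_half_plane u d - {u, - u} = sphere 0 1 \<inter> open_half_plane u d"
proof (intro equalityI subsetI)
  fix x assume "x \<in> sphere 0 1 \<inter> closed_half_plane u d - {u, - u}"
  then obtain s t where x: "x = s *\<^sub>R u + t *\<^sub>R d" "0 \<le> t" "norm x = 1" "x \<noteq> u" "x \<noteq> - u"
    by (auto simp: closed_half_plane_def)
  have "t \<noteq> 0"
  proof
    assume "t = 0" then have "s = 1 \<or> s = -1" using x assms by auto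
    then show False using \<open>t = 0\<close> x by auto
  qed
  then have "0 < t" using x by auto
  then show "x \<in> sphere 0 1 \<inter> open_half_plane u d" using x by (auto simp: open_half_plane_def)
next
  fix x assume "x \<in> sphere 0 1 \<inter> open_half_plane u d"
  then obtain s t where x: "x = s *\<^sub>R u + t *\<^sub>R d" "0 < t" "norm x = 1"
    by (auto simp: open_half_plane_def)
  note D = indep2_orthonormal[OF assms, unfolded indep2_def, rule_format]
  have "x \<noteq> u"
  proof
    assume "x = u" then have "(s - 1) *\<^sub>R u + t *\<^sub>R d = 0" using x by (simp add: algebra_simps)
    then show False using D x by blast
  qed
  moreover have "x \<noteq> - u"
  proof
    assume "x = - u" then have "(s + 1) *\<^sub>R u + t *\<^sub>R d = 0" using x by (simp add: algebra_simps)
    then show False using D x by blast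
  qed
  ultimately show "x \<in> sphere 0 1 \<inter> closed_half_plane u d - {u, - u}"
    using x by (force simp: closed_half_plane_def)
qed

lemma indep3_rotate: "indep3 u v w \<Longrightarrow> indep3 v w u"
  unfolding indep3_def
proof (intro allI impI)
  fix \<alpha> \<beta> \<gamma>
  assume u: "\<forall>\<alpha> \<beta> \<gamma>. \<alpha> *\<^sub>R u + \<beta> *\<^sub>R v + \<gamma> *\<^sub>R w = 0 \<longrightarrow> \<alpha> = 0 \<and> \<beta> = 0 \<and> \<gamma> = 0"
    and "\<alpha> *\<^sub>R v + \<beta> *\<^sub>R w + \<gamma> *\<^sub>R u = 0"
  then have "\<gamma> *\<^sub>R u + \<alpha> *\<^sub>R v + \<beta> *\<^sub>R w = 0" by (simp add: algebra_simps)
  then show "\<alpha> = 0 \<and> \<beta> = 0 \<and> \<gamma> = 0" using u by blast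
qed

lemma indep3_swap:
  assumes "indep3 u v w" shows "indep3 v u w"
  unfolding indep3_def
proof (intro allI impI)
  fix \<alpha> \<beta> \<gamma> assume "\<alpha> *\<^sub>R v + \<beta> *\<^sub>R u + \<gamma> *\<^sub>R w = 0"
  then have "\<beta> *\<^sub>R u + \<alpha> *\<^sub>R v + \<gamma> *\<^sub>R w = 0" by (simp add: add.commute)
  then show "\<alpha> = 0 \<and> \<beta> = 0 \<and> \<gamma> = 0" using assms unfolding indep3_def by blast
qed

lemma indep3_minus:
  assumes "indep3 u v w" shows "indep3 (- u) v w"
  unfolding indep3_def
proof (intro allI impI)
  fix \<alpha> \<beta> \<gamma> assume "\<alpha> *\<^sub>R (- u) + \<beta> *\<^sub>R v + \<gamma> *\<^sub>R w = 0"
  then have "(- \<alpha>) *\<^sub>R u + \<beta> *\<^sub>R v + \<gamma> *\<^sub>R w = 0" by simp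
  then show "\<alpha> = 0 \<and> \<beta> = 0 \<and> \<gamma> = 0" using assms unfolding indep3_def by (metis neg_equal_0_iff_equal)
qed

lemma positive_multiples_unit_eq:
  fixes w :: "'a::real_normed_vector"
  assumes "norm (s *\<^sub>R w) = 1" "norm (t *\<^sub>R w) = 1" "0 < s" "0 < t"
  shows "s *\<^sub>R w = t *\<^sub>R w"
proof -
  have "s * norm w = t * norm w" using assms by simp
  moreover have "norm w \<noteq> 0" using assms by auto
  ultimately show ?thesis by simp
qed

lemma closed_half_plane_minus: "closed_half_plane (- u) d = closed_half_plane u d"
proof -
  have "closed_half_plane (- u) d \<subseteq> closed_half_plane u d" for u
  proof
    fix x assume "x \<in> closed_half_plane (- u) d"
    then obtain s t where "x = (- s) *\<^sub>R u + t *\<^sub>R d" "0 \<le> t" by (auto simp: closed_half_plane_def)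
    then show "x \<in> closed_half_plane u d" unfolding closed_half_plane_def by blast
  qed
  from this[of u] this[of "- u"] show ?thesis by simp
qed

lemma unit_ne_minus:
  fixes u :: "'a::real_normed_vector"
  assumes "norm u = 1" shows "u \<noteq> - u"
proof
  assume "u = - u"
  then have "2 *\<^sub>R u = 0" by (metis add.right_inverse scaleR_2)
  then show False using assms by auto
qed

text \<open>If - p were in P as well, any third point of P would give a triple containing two
  antipodes, which is linearly dependent; a third point exists because P has at least three.\<close>

lemma general_position_no_antipodes:
  assumes "general_position P" "3 \<le> card P" "P \<subseteq> sphere 0 1" "p \<in> P"
  shows "- p \<notin> P"
proof
  assume m: "- p \<in> P"
  have "norm p = 1" using assms by auto
  then have "p \<noteq> - p" by (rule unit_ne_minus)
  have fin: "finite P" using assms(2) card.infinite by fastforce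
  have "\<not> P \<subseteq> {p, - p}"
  proof
    assume "P \<subseteq> {p, - p}"
    then have "card P \<le> card {p, - p}" by (intro card_mono) auto
    then show False using assms(2) \<open>p \<noteq> - p\<close> by simp
  qed
  then obtain z where z: "z \<in> P" "z \<noteq> p" "z \<noteq> - p" by auto
  have "\<not> (\<exists>C. great_circle C \<and> {p, - p, z} \<subseteq> C)"
    using assms(1)[unfolded general_position_def, rule_format, OF assms(4) m z(1)]
      z(2,3) \<open>p \<noteq> - p\<close> by (simp add: eq_commute[of _ z])
  moreover have "norm (- p) = 1" "norm z = 1" using assms z by auto
  ultimately have "indep3 p (- p) z"
    using \<open>norm p = 1\<close> by (intro indep3_if_not_great_circle)
  from this[unfolded indep3_def, rule_format, of 1 1 0] show False by simp
qed

text \<open>Cones are invariant under positive scaling, so a crossing may be found as any nonzero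
  common vector and then moved onto the sphere.\<close>

lemma open_sector_normalize: "x \<in> open_sector u v \<Longrightarrow> x \<noteq> 0 \<Longrightarrow> x /\<^sub>R norm x \<in> open_sector u v"
proof -
  assume "x \<in> open_sector u v" "x \<noteq> 0"
  then obtain s t where x: "x = s *\<^sub>R u + t *\<^sub>R v" "0 < s" "0 < t" by (auto simp: open_sector_def)
  then have "x /\<^sub>R norm x = (s / norm x) *\<^sub>R u + (t / norm x) *\<^sub>R v"
    by (simp add: scaleR_add_right divide_inverse_commute)
  then show ?thesis using x \<open>x \<noteq> 0\<close> unfolding open_sector_def
    by (metis (mono_tags, lifting) divide_pos_pos mem_Collect_eq zero_less_norm_iff)
qed

lemma open_half_plane_normalize: "x \<in> open_half_plane u v \<Longrightarrow> x \<noteq> 0 \<Longrightarrow> x /\<^sub>R norm x \<in> open_half_plane u v"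
proof -
  assume "x \<in> open_half_plane u v" "x \<noteq> 0"
  then obtain s t where x: "x = s *\<^sub>R u + t *\<^sub>R v" "0 < t" by (auto simp: open_half_plane_def)
  then have "x /\<^sub>R norm x = (s / norm x) *\<^sub>R u + (t / norm x) *\<^sub>R v"
    by (simp add: scaleR_add_right divide_inverse_commute)
  then show ?thesis using x \<open>x \<noteq> 0\<close> unfolding open_half_plane_def
    by (metis (mono_tags, lifting) divide_pos_pos mem_Collect_eq zero_less_norm_iff)
qed

text \<open>Moves the sign of a coordinate into the vector. This is how the sign of a coordinate
  selects one point of an antipodal pair.\<close>

lemma signed_multiple:
  fixes u :: "'a::real_vector"
  assumes "\<alpha> \<noteq> 0"
  obtains \<alpha>' u' where "0 < \<alpha>'" "u' = u \<or> u' = - u" "\<alpha> *\<^sub>R u = \<alpha>' *\<^sub>R u'"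
proof (cases "0 < \<alpha>")
  case True then show thesis using that by blast
next
  case False
  have "\<alpha> *\<^sub>R u = (- \<alpha>) *\<^sub>R (- u)" by simp
  then show thesis using that[of "- \<alpha>" "- u"] False assms by simp
qed

text \<open>If u' were - u, comparing the coefficients of u would equate a positive with a negative
  number. The sign choices made by \<open>signed_multiple\<close> are thus forced, which gives
  injectivity in the counts below.\<close>

lemma indep3_sign_unique:
  assumes "indep3 u v w" "u' = u \<or> u' = - u" "v' = v \<or> v' = - v" "w' = w \<or> w' = - w"
    and "\<alpha> *\<^sub>R u + \<beta> *\<^sub>R v + \<gamma> *\<^sub>R w = \<alpha>' *\<^sub>R u' + \<beta>' *\<^sub>R v' + \<gamma>' *\<^sub>R w'"
    and "0 < \<alpha>" "0 < \<alpha>'"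
  shows "u' = u"
proof (rule ccontr)
  assume "u' \<noteq> u"
  then have "u' = - u" using assms by blast
  obtain \<delta> \<epsilon> where "\<beta>' *\<^sub>R v' = \<delta> *\<^sub>R v" "\<gamma>' *\<^sub>R w' = \<epsilon> *\<^sub>R w"
    using assms(3,4) by (metis scaleR_minus_left scaleR_minus_right)
  then have "\<alpha> *\<^sub>R u + \<beta> *\<^sub>R v + \<gamma> *\<^sub>R w = (- \<alpha>') *\<^sub>R u + \<delta> *\<^sub>R v + \<epsilon> *\<^sub>R w"
    using assms(5) \<open>u' = - u\<close> by simp
  then have "\<alpha> = - \<alpha>'" using indep3_eqD(1)[OF assms(1)] by blast
  then show False using assms by simp
qed

text \<open>The coefficients of u are left free, because on the half-circle joining u and - u this
  coordinate takes both signs.\<close>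

lemma indep3_signs_unique:
  assumes ind: "indep3 u v w"
    and s: "u' = u \<or> u' = - u" "v' = v \<or> v' = - v" "w' = w \<or> w' = - w"
    and eq: "\<alpha> *\<^sub>R u + \<beta> *\<^sub>R v + \<gamma> *\<^sub>R w = \<alpha>' *\<^sub>R u' + \<beta>' *\<^sub>R v' + \<gamma>' *\<^sub>R w'"
    and pos: "0 < \<beta>" "0 < \<beta>'" "0 < \<gamma>" "0 < \<gamma>'"
  shows "v' = v" "w' = w"
proof -
  have "\<beta> *\<^sub>R v + \<gamma> *\<^sub>R w + \<alpha> *\<^sub>R u = \<beta>' *\<^sub>R v' + \<gamma>' *\<^sub>R w' + \<alpha>' *\<^sub>R u'"
    using eq by (simp add: algebra_simps)
  then show "v' = v"
    using indep3_sign_unique[OF indep3_rotate[OF ind] s(2,3,1)] pos by blast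
  have "\<gamma> *\<^sub>R w + \<alpha> *\<^sub>R u + \<beta> *\<^sub>R v = \<gamma>' *\<^sub>R w' + \<alpha>' *\<^sub>R u' + \<beta>' *\<^sub>R v'"
    using eq by (simp add: algebra_simps)
  then show "w' = w"
    using indep3_sign_unique[OF indep3_rotate[OF indep3_rotate[OF ind]] s(3,1,2)] pos by blast
qed

section \<open>Sets of crossings and the values of \<open>H\<close>\<close>

lemma crossingsI:
  assumes "e \<in> E" "f \<in> E" "e \<noteq> f" "x \<in> D e - e" "x \<in> D f - f"
  shows "({e, f}, x) \<in> crossings E D"
  using assms unfolding crossings_def by blast

lemma crossings_cases:
  assumes "c \<in> crossings E D"
  obtains e f x where "c = ({e, f}, x)" "e \<in> E" "f \<in> E" "e \<noteq> f" "x \<in> D e - e" "x \<in> D f - f"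
  using assms unfolding crossings_def by blast

lemma crossings_mono: "E \<subseteq> E' \<Longrightarrow> crossings E D \<subseteq> crossings E' D"
  unfolding crossings_def by blast

lemma complete_edges_mono: "V \<subseteq> W \<Longrightarrow> complete_edges V \<subseteq> complete_edges W"
  by (auto simp: complete_edges_def)

lemma real_choose_two: "real (n choose 2) = real n * (real n - 1) / 2"
  by (induction n) (auto simp: numeral_2_eq_2 field_simps)

lemma H_even: "H (2 * j) = of_int j * (of_int j - 1)\<^sup>2 * (of_int j - 2) / 4"
proof -
  have "\<lfloor>of_int (2 * j) / 2 :: real\<rfloor> = j" "\<lfloor>(of_int (2 * j) - 1) / 2 :: real\<rfloor> = j - 1"
    "\<lfloor>(of_int (2 * j) - 2) / 2 :: real\<rfloor> = j - 1" "\<lfloor>(of_int (2 * j) - 3) / 2 :: real\<rfloor> = j - 2"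
    by (rule floor_unique; simp add: field_simps)+
  then show ?thesis unfolding H_def by (simp add: power2_eq_square)
qed

lemma H_odd: "H (2 * j + 1) = (of_int j)\<^sup>2 * (of_int j - 1)\<^sup>2 / 4"
proof -
  have "\<lfloor>of_int (2 * j + 1) / 2 :: real\<rfloor> = j" "\<lfloor>(of_int (2 * j + 1) - 1) / 2 :: real\<rfloor> = j"
    "\<lfloor>(of_int (2 * j + 1) - 2) / 2 :: real\<rfloor> = j - 1" "\<lfloor>(of_int (2 * j + 1) - 3) / 2 :: real\<rfloor> = j - 1"
    by (rule floor_unique; simp add: field_simps)+
  then show ?thesis unfolding H_def by (simp add: power2_eq_square)
qed

subsection \<open>The drawing\<close>

text \<open>
  Here \<open>q\<close> is either one of the points of \<open>S\<close>, so that \<open>X = S\<close>, or an added point, so that all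
  crossings at a vertex are counted at once.
\<close>

locale antipodal_configuration =
  fixes P :: "(real^3) set" and h :: "(real^3) set \<Rightarrow> (real^3) set" and q :: "real^3"
  fixes S X D
  defines "S \<equiv> P \<union> uminus ` P" and "X \<equiv> insert q S" and "D \<equiv> antipodal_drawing P h"
  assumes fin: "finite P" and card3: "3 \<le> card P" and unit: "P \<subseteq> sphere 0 1"
    and gp: "general_position P"
    and half: "\<And>p. p \<in> P \<Longrightarrow> half_circle p (h {p, - p})"
    and nocross: "crossings (antipodal_pairs P) h = {}"
    and q_unit: "norm q = 1"
    \<comment> \<open>For q in S the independence comes from general position of P, hence the guard;
      for an added q it is the general position with respect to S.\<close>
    and q_indep: "\<And>a b. \<lbrakk>a \<in> P; b \<in> P; a \<noteq> b; q \<notin> S\<rbrakk> \<Longrightarrow> indep3 q a b"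
    and avoid: "\<And>p w. \<lbrakk>p \<in> P; w \<in> X; w \<noteq> p; w \<noteq> - p\<rbrakk> \<Longrightarrow> w \<notin> h {p, - p}"
begin

lemma fin_X: "finite X" and fin_S: "finite S"
  using fin by (auto simp: X_def S_def)

lemma no_antipodes: "p \<in> P \<Longrightarrow> - p \<notin> P"
  using general_position_no_antipodes gp card3 unit by blast

lemma unit_X: "u \<in> X \<Longrightarrow> norm u = 1"
  using unit q_unit by (auto simp: X_def S_def)

lemma S_sub: "u \<in> S \<Longrightarrow> u \<in> X" "u \<in> P \<Longrightarrow> u \<in> X" "u \<in> P \<Longrightarrow> u \<in> S"
  by (auto simp: X_def S_def)

lemma neg_ne: "u \<in> X \<Longrightarrow> u \<noteq> - u" "u \<in> X \<Longrightarrow> - u \<noteq> u"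
  using unit_ne_minus[OF unit_X] by metis+

lemma S_uminus: "u \<in> S \<Longrightarrow> - u \<in> S"
  by (auto simp: S_def)

text \<open>An added q creates no new antipodal pair: its antipode would be a point of S, and S is
  closed under negation. Every edge between antipodes is therefore one of the given
  half-circles.\<close>

lemma S_if_antipodes: "u \<in> X \<Longrightarrow> - u \<in> X \<Longrightarrow> u \<in> S"
  using S_uminus neg_ne unfolding X_def by (metis insertE minus_minus)

lemma S_cases:
  assumes "u \<in> S" obtains "u \<in> P" "- u \<notin> P" | "- u \<in> P" "u \<notin> P"
  using assms no_antipodes by (force simp: S_def)

lemma indep_P: 
  assumes "a \<in> P" "b \<in> P" "c \<in> P" "a \<noteq> b" "a \<noteq> c" "b \<noteq> c"
  shows "indep3 a b c"
proof (rule indep3_if_not_great_circle)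
  show "norm a = 1" "norm b = 1" "norm c = 1" using assms unit by auto
  show "\<not> (\<exists>C. great_circle C \<and> {a, b, c} \<subseteq> C)"
    using gp assms unfolding general_position_def by blast
qed

text \<open>The points are signed points of P from three different pairs, and changing signs
  preserves independence.\<close>

lemma indep_S:
  assumes "u \<in> S" "v \<in> S" "w \<in> S" "v \<noteq> u" "v \<noteq> - u" "w \<noteq> u" "w \<noteq> - u" "w \<noteq> v" "w \<noteq> - v"
  shows "indep3 u v w"
proof -
  have red: "\<exists>a\<in>P. (u = a \<or> u = - a)" if "u \<in> S" for u using that by (auto simp: S_def)
  obtain a b c where abc: "a \<in> P" "b \<in> P" "c \<in> P"
     "u = a \<or> u = - a" "v = b \<or> v = - b" "w = c \<or> w = - c"
    using red assms(1-3) by metis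
  have "a \<noteq> b" "a \<noteq> c" "b \<noteq> c" using abc assms by auto
  then have "indep3 a b c" using indep_P abc by blast
  then show ?thesis using abc(4-6)
    by (metis indep3_minus indep3_rotate)
qed

lemma indep_q:
  assumes "v \<in> S" "w \<in> S" "w \<noteq> v" "w \<noteq> - v" "q \<notin> S"
  shows "indep3 q v w"
proof -
  have red: "\<exists>a\<in>P. (u = a \<or> u = - a)" if "u \<in> S" for u using that by (auto simp: S_def)
  obtain b c where abc: "b \<in> P" "c \<in> P"
     "v = b \<or> v = - b" "w = c \<or> w = - c"
    using red assms(1-2) by metis
  have "b \<noteq> c" using abc assms by auto
  then have "indep3 q b c" using q_indep abc assms by blast
  then show ?thesis using abc(3-4)
    by (metis indep3_minus indep3_rotate)
qed

lemma indep_X: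
  assumes "u \<in> X" "v \<in> X" "w \<in> X" "v \<noteq> u" "v \<noteq> - u" "w \<noteq> u" "w \<noteq> - u" "w \<noteq> v" "w \<noteq> - v"
  shows "indep3 u v w"
proof (cases "u \<in> S \<and> v \<in> S \<and> w \<in> S")
  case True
  then show ?thesis using indep_S assms by blast
next
  case False
  then have q: "q \<notin> S" and "u = q \<or> v = q \<or> w = q" using assms(1-3) by (auto simp: X_def)
  then consider "u = q" "v \<in> S" "w \<in> S" | "v = q" "u \<in> S" "w \<in> S" | "w = q" "v \<in> S" "u \<in> S"
    using assms by (auto simp: X_def)
  then show ?thesis
    using indep_q[OF _ _ _ _ q] assms indep3_rotate indep3_swap
    by cases metis+
qed

lemma not_antipodal_pair: "v \<noteq> - u \<Longrightarrow> {u, v} \<notin> antipodal_pairs P"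
  by (auto simp: antipodal_pairs_def doubleton_eq_iff)

text \<open>An edge does not order its endpoints, but the arcs for both orders fill the same sector,
  so the definite description in \<open>antipodal_drawing\<close> denotes a unique set.\<close>

lemma D_arc:
  assumes "u \<in> X" "v \<in> X" "v \<noteq> u" "v \<noteq> - u"
  shows "geodesic_arc u v (D {u, v})" "D {u, v} = sphere 0 1 \<inter> closed_sector u v"
proof -
  have un: "norm u = 1" "norm v = 1" using assms unit_X by auto
  obtain A where A: "geodesic_arc u v A" using geodesic_arc_exists un assms by blast
  have Ae: "A = sphere 0 1 \<inter> closed_sector u v" using geodesic_arc_eq_cone A assms by blast
  have "(THE A. \<exists>u' v'. {u, v} = {u', v'} \<and> geodesic_arc u' v' A) = A"
  proof (rule the_equality)
    show "\<exists>u' v'. {u, v} = {u', v'} \<and> geodesic_arc u' v' A" using A by blast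
  next
    fix B assume "\<exists>u' v'. {u, v} = {u', v'} \<and> geodesic_arc u' v' B"
    then have "geodesic_arc u v B \<or> geodesic_arc v u B" by (auto simp: doubleton_eq_iff)
    then show "B = A" using geodesic_arc_eq_cone assms Ae closed_sector_commute by (metis minus_minus)
  qed
  then have "D {u, v} = A"
    using not_antipodal_pair[OF assms(4)] by (simp add: D_def antipodal_drawing_def)
  then show "geodesic_arc u v (D {u, v})" "D {u, v} = sphere 0 1 \<inter> closed_sector u v"
    using A Ae by auto
qed

lemma D_antipodal: "p \<in> P \<Longrightarrow> D {p, - p} = h {p, - p}"
  by (auto simp: D_def antipodal_drawing_def antipodal_pairs_def)

lemma D_half_exists:
  assumes "u \<in> S"
  shows "\<exists>d. norm d = 1 \<and> u \<bullet> d = 0 \<and> D {u, - u} = sphere 0 1 \<inter> closed_half_plane u d"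
  using assms
proof (cases rule: S_cases)
  case 1
  then show ?thesis using half_circle_eq_half_plane[OF half] D_antipodal by metis
next
  case 2
  then obtain d where "norm d = 1" "(- u) \<bullet> d = 0" "h {- u, - (- u)} = sphere 0 1 \<inter> closed_half_plane (- u) d"
    using half_circle_eq_half_plane[OF half] by metis
  moreover have "D {u, - u} = h {- u, - (- u)}"
    using D_antipodal[OF 2(1)] by (simp add: insert_commute)
  ultimately show ?thesis using closed_half_plane_minus by auto
qed

text \<open>For u in S, this is the midpoint of the half-circle joining u and - u.\<close>

definition dir :: "real^3 \<Rightarrow> real^3" where
  "dir u = (SOME d. norm d = 1 \<and> u \<bullet> d = 0 \<and> D {u, - u} = sphere 0 1 \<inter> closed_half_plane u d)"

lemma dir:
  assumes "u \<in> S"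
  shows "norm (dir u) = 1" "u \<bullet> dir u = 0" "D {u, - u} = sphere 0 1 \<inter> closed_half_plane u (dir u)"
  using someI_ex[OF D_half_exists[OF assms]] unfolding dir_def by auto

text \<open>Vertices are unit vectors, so avoiding the half-circle means avoiding its whole
  half-plane, which is the form suited to coordinates.\<close>

lemma dir_avoid:
  assumes "u \<in> S" "w \<in> X" "w \<noteq> u" "w \<noteq> - u"
  shows "w \<notin> closed_half_plane u (dir u)"
proof -
  have "w \<notin> D {u, - u}"
    using assms(1)
  proof (cases rule: S_cases)
    case 1
    then show ?thesis using avoid[OF 1(1) assms(2)] assms D_antipodal by auto
  next
    case 2
    then show ?thesis using avoid[OF 2(1) assms(2)] assms D_antipodal[OF 2(1)]
      by (auto simp: insert_commute)
  qed
  then show ?thesis using dir(3)[OF assms(1)] unit_X[OF assms(2)] by auto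
qed

lemma edge_cases:
  assumes "e \<in> complete_edges X"
  obtains u v where "e = {u, v}" "u \<in> X" "v \<in> X" "v \<noteq> u" "v \<noteq> - u"
  | p where "e = {p, - p}" "p \<in> P"
proof -
  obtain u v where uv: "e = {u, v}" "u \<noteq> v" "u \<in> X" "v \<in> X"
    using assms by (auto simp: complete_edges_def card_2_iff)
  show thesis
  proof (cases "v = - u")
    case True
    then have "u \<in> S" using S_if_antipodes uv by auto
    then show thesis
    proof (cases rule: S_cases)
      case 1 then show thesis using that(2) uv True by auto
    next
      case 2 then show thesis using that(2)[of "- u"] uv True by (auto simp: insert_commute)
    qed
  next
    case False
    then show thesis using that(1) uv by metis
  qed
qed

abbreviation edge_interior :: "(real^3) set \<Rightarrow> (real^3) set" where
  "edge_interior e \<equiv> D e - e"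

lemma edge_interior_arc:
  assumes "u \<in> X" "v \<in> X" "v \<noteq> u" "v \<noteq> - u"
  shows "edge_interior {u, v} = sphere 0 1 \<inter> open_sector u v"
  using D_arc[OF assms] arc_interior unit_X assms by auto

lemma edge_interior_half:
  assumes "u \<in> S"
  shows "edge_interior {u, - u} = sphere 0 1 \<inter> open_half_plane u (dir u)"
  using dir[OF assms] half_circle_interior[of u "dir u"] unit_X S_sub(1)[OF assms] by auto

text \<open>A further vertex on an arc would satisfy a linear relation with its endpoints: for the
  antipode of an endpoint this contradicts the signs, for any other vertex independence. For
  half-circles it is \<open>dir_avoid\<close>.\<close>

lemma edge_meets_vertices:
  assumes "e \<in> complete_edges X"
  shows "D e \<inter> X = e"
  using assms
proof (cases rule: edge_cases)
  case (1 u v)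
  have un: "norm u = 1" "norm v = 1" using 1 unit_X by auto
  have "u = 1 *\<^sub>R u + 0 *\<^sub>R v" "v = 0 *\<^sub>R u + 1 *\<^sub>R v" by simp_all
  then have "u \<in> closed_sector u v" "v \<in> closed_sector u v"
    unfolding closed_sector_def by (metis (mono_tags, lifting) mem_Collect_eq order_refl zero_le_one)+
  moreover have "w \<notin> closed_sector u v" if "w \<in> X" "w \<noteq> u" "w \<noteq> v" for w
  proof
    assume "w \<in> closed_sector u v"
    then obtain s t where w: "w = s *\<^sub>R u + t *\<^sub>R v" "0 \<le> s" "0 \<le> t" by (auto simp: closed_sector_def)
    note D2 = indep2_unit[OF un 1(4,5), unfolded indep2_def, rule_format]
    show False
    proof (cases "w = - u \<or> w = - v")
      case True
      then show False
      proof
        assume "w = - u"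
        then have "(1 + s) *\<^sub>R u + t *\<^sub>R v = 0" using w by (simp add: algebra_simps)
        then show False using D2[of "1 + s" t] w by simp
      next
        assume "w = - v"
        then have "s *\<^sub>R u + (1 + t) *\<^sub>R v = 0" using w by (simp add: algebra_simps)
        then show False using D2[of s "1 + t"] w by simp
      qed
    next
      case False
      then have "indep3 u v w" using indep_X 1 that by metis
      moreover have "s *\<^sub>R u + t *\<^sub>R v + 0 *\<^sub>R w = 0 *\<^sub>R u + 0 *\<^sub>R v + 1 *\<^sub>R w" using w by simp
      ultimately show False using indep3_eqD(3) by fastforce
    qed
  qed
  ultimately show ?thesis unfolding 1(1) D_arc(2)[OF 1(2-5)] using 1 un by auto
next
  case (2 p)
  have "p \<in> S" using 2 S_sub by auto
  have "p = 1 *\<^sub>R p + 0 *\<^sub>R d" "- p = (-1) *\<^sub>R p + 0 *\<^sub>R d" for d by simp_all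
  then have "p \<in> closed_half_plane p d" "- p \<in> closed_half_plane p d" for d
    unfolding closed_half_plane_def by (metis (mono_tags, lifting) mem_Collect_eq order_refl)+
  then show ?thesis
    unfolding 2(1) dir(3)[OF \<open>p \<in> S\<close>]
    using dir_avoid[OF \<open>p \<in> S\<close>] S_sub(1)[OF \<open>p \<in> S\<close>] S_sub(1)[OF S_uminus[OF \<open>p \<in> S\<close>]] unit_X by auto
qed

text \<open>Stated for every subset of X, so that it serves the full drawing, the deletion of a
  point and the addition of q alike.\<close>

lemma complete_drawing:
  assumes "V \<subseteq> X"
  shows "geodesic_drawing_of_complete_graph (card V) V D"
  unfolding geodesic_drawing_of_complete_graph_def geodesic_drawing_def
proof (intro conjI ballI)
  show "finite V" using assms fin_X finite_subset by blast
  show "V \<subseteq> sphere 0 1" using assms unit_X by auto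
  fix e assume e: "e \<in> complete_edges V"
  then have eX: "e \<in> complete_edges X" using assms by (auto simp: complete_edges_def)
  have eV: "e \<subseteq> V" using e by (simp add: complete_edges_def)
  show "D e \<inter> V = e" using edge_meets_vertices[OF eX] assms eV by blast
  from eX show "\<exists>u\<in>V. \<exists>v\<in>V. u \<noteq> v \<and> e = {u, v} \<and> geodesic_arc u v (D e)"
  proof (cases rule: edge_cases)
    case (1 u v)
    then show ?thesis using D_arc(1)[OF 1(2-5)] eV by (intro bexI[of _ u] bexI[of _ v]) auto
  next
    case (2 p)
    have "p \<noteq> - p" using neg_ne S_sub 2 by blast
    moreover have "half_circle p (D e)" using half D_antipodal 2 by auto
    moreover have "p \<in> V" "- p \<in> V" using 2 eV by auto
    ultimately show ?thesis using 2 by blast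
  qed
qed simp

subsection \<open>Crossings of two edges\<close>

lemma dir_indep: "u \<in> S \<Longrightarrow> indep2 u (dir u)"
  using dir indep2_orthonormal unit_X S_sub by blast

lemma dir_nz:
  assumes "u \<in> S" "s *\<^sub>R u + t *\<^sub>R dir u = 0"
  shows "s = 0" "t = 0"
  using dir_indep[OF assms(1)] assms(2) unfolding indep2_def by blast+

text \<open>Solving a common point for w gives a positive coefficient at \<open>dir u\<close>, so w
  would lie in the half-plane of u, which contains no other vertices.\<close>

lemma half_share:
  assumes "u \<in> S" "w \<in> X" "w \<noteq> u" "w \<noteq> - u"
  shows "edge_interior {u, - u} \<inter> edge_interior {u, w} = {}"
proof -
  have "open_half_plane u (dir u) \<inter> open_sector u w = {}"
  proof (rule ccontr)
    assume "open_half_plane u (dir u) \<inter> open_sector u w \<noteq> {}"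
    then obtain s t s' t' where e: "s *\<^sub>R u + t *\<^sub>R dir u = s' *\<^sub>R u + t' *\<^sub>R w" "0 < t" "0 < s'" "0 < t'"
      unfolding open_half_plane_def open_sector_def by auto
    then have "t' *\<^sub>R w = (s - s') *\<^sub>R u + t *\<^sub>R dir u" by (simp add: algebra_simps)
    also have "\<dots> = t' *\<^sub>R (((s - s') / t') *\<^sub>R u + (t / t') *\<^sub>R dir u)"
      using e by (simp add: scaleR_add_right scaleR_diff_right)
    finally have "w = ((s - s') / t') *\<^sub>R u + (t / t') *\<^sub>R dir u"
      using e by simp
    moreover have "0 \<le> t / t'" using e by simp
    ultimately have "w \<in> closed_half_plane u (dir u)" unfolding closed_half_plane_def by blast
    then show False using dir_avoid assms by blast
  qed
  then show ?thesis
    using edge_interior_half[OF assms(1)] edge_interior_arc[OF S_sub(1)[OF assms(1)] assms(2-4)] by auto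
qed

text \<open>Modulo the line of u, a common interior point would make v and w point in the same
  direction; they are independent or opposite there. If one edge is a half-circle,
  \<open>half_share\<close> applies.\<close>

lemma edges_sharing_vertex:
  assumes "u \<in> X" "v \<in> X" "w \<in> X" "v \<noteq> u" "w \<noteq> u" "v \<noteq> w"
  shows "edge_interior {u, v} \<inter> edge_interior {u, w} = {}"
proof -
  consider "v = - u" | "w = - u" | "v \<noteq> - u" "w \<noteq> - u" by blast
  then show ?thesis
  proof cases
    case 1
    then show ?thesis using half_share[of u w] S_if_antipodes assms by auto
  next
    case 2
    then show ?thesis using half_share[of u v] S_if_antipodes assms by auto
  next
    case 3
    have "open_sector u v \<inter> open_sector u w = {}"
    proof (rule ccontr)
      assume "open_sector u v \<inter> open_sector u w \<noteq> {}"
      then obtain s t s' t' where e: "s *\<^sub>R u + t *\<^sub>R v = s' *\<^sub>R u + t' *\<^sub>R w" "0 < t" "0 < t'"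
        unfolding open_sector_def by auto
      show False
      proof (cases "w = - v")
        case True
        then have "(s - s') *\<^sub>R u + (t + t') *\<^sub>R v = 0" using e by (simp add: algebra_simps)
        then have "t + t' = 0"
          using indep2_unit[OF unit_X[OF assms(1)] unit_X[OF assms(2)] assms(4) 3(1)]
          unfolding indep2_def by blast
        then show False using e by simp
      next
        case False
        have "indep3 u v w" by (rule indep_X) (use assms 3 False in auto)
        from indep3_eqD(2)[OF this, of s t 0 s' 0 t'] show False using e by simp
      qed
    qed
    then show ?thesis using edge_interior_arc 3 assms by auto
  qed
qed

text \<open>Working modulo the line of u handles antipodal endpoints as it does a shared one, since
  only the coefficients of v and w matter.\<close>

lemma edges_at_antipodes:
  assumes "u \<in> X" "- u \<in> X" "v \<in> X" "w \<in> X" "v \<noteq> u" "v \<noteq> - u" "w \<noteq> u" "w \<noteq> - u"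
  shows "edge_interior {u, v} \<inter> edge_interior {- u, w} = {}"
proof (cases "v = w")
  case True
  then show ?thesis using edges_sharing_vertex[of v u "- u"] assms neg_ne
    by (simp add: insert_commute)
next
  case False
  have "open_sector u v \<inter> open_sector (- u) w = {}"
  proof (rule ccontr)
    assume "open_sector u v \<inter> open_sector (- u) w \<noteq> {}"
    then obtain s t s' t' where e: "s *\<^sub>R u + t *\<^sub>R v = s' *\<^sub>R (- u) + t' *\<^sub>R w" "0 < t" "0 < t'"
      unfolding open_sector_def by auto
    show False
    proof (cases "w = - v")
      case True
      then have "(s + s') *\<^sub>R u + (t + t') *\<^sub>R v = 0" using e by (simp add: algebra_simps)
      then have "t + t' = 0"
        using indep2_unit[OF unit_X[OF assms(1)] unit_X[OF assms(3)] assms(5,6)]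
        unfolding indep2_def by blast
      then show False using e by simp
    next
      case f: False
      have "indep3 u v w" by (rule indep_X) (use assms False f in auto)
      from indep3_eqD(2)[OF this, of s t 0 "- s'" 0 t'] show False using e by simp
    qed
  qed
  moreover have "w \<noteq> - (- u)" using assms by simp
  ultimately show ?thesis using edge_interior_arc assms by (auto simp del: minus_minus)
qed

text \<open>A vector common to both open sectors can be solved for u and divided by the positive
  coefficient of u. Thus u lies in the open cone spanned by - v, w and z.\<close>

lemma crossing_arcs_iff:
  assumes X: "u \<in> X" "v \<in> X" "w \<in> X" "z \<in> X"
    and ne: "v \<noteq> u" "v \<noteq> - u" "z \<noteq> w" "z \<noteq> - w" "w \<noteq> u" "w \<noteq> - u"
  shows "edge_interior {u, v} \<inter> edge_interior {w, z} \<noteq> {} \<longleftrightarrow>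
    (\<exists>\<alpha> \<beta> \<gamma>. 0 < \<alpha> \<and> 0 < \<beta> \<and> 0 < \<gamma> \<and> u = (- \<alpha>) *\<^sub>R v + \<beta> *\<^sub>R w + \<gamma> *\<^sub>R z)"
    (is "?L \<longleftrightarrow> ?R")
proof
  assume ?L
  then have "open_sector u v \<inter> open_sector w z \<noteq> {}" using edge_interior_arc assms by auto
  then obtain s t s' t' where e: "s *\<^sub>R u + t *\<^sub>R v = s' *\<^sub>R w + t' *\<^sub>R z"
    "0 < s" "0 < t" "0 < s'" "0 < t'"
    unfolding open_sector_def by auto
  then have "s *\<^sub>R u = (- t) *\<^sub>R v + s' *\<^sub>R w + t' *\<^sub>R z" by (simp add: algebra_simps)
  also have "\<dots> = s *\<^sub>R ((- (t / s)) *\<^sub>R v + (s' / s) *\<^sub>R w + (t' / s) *\<^sub>R z)"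
    using e by (simp add: scaleR_add_right scaleR_diff_right)
  finally have "u = (- (t / s)) *\<^sub>R v + (s' / s) *\<^sub>R w + (t' / s) *\<^sub>R z"
    using e by (simp del: scaleR_minus_left)
  moreover have "0 < t / s" "0 < s' / s" "0 < t' / s" using e by simp_all
  ultimately show ?R by blast
next
  assume ?R
  then obtain \<alpha> \<beta> \<gamma> where pos: "0 < \<alpha>" "0 < \<beta>" "0 < \<gamma>" and "u = (- \<alpha>) *\<^sub>R v + \<beta> *\<^sub>R w + \<gamma> *\<^sub>R z"
    by blast
  then have e: "1 *\<^sub>R u + \<alpha> *\<^sub>R v = \<beta> *\<^sub>R w + \<gamma> *\<^sub>R z" by (simp add: algebra_simps)
  define x where "x = 1 *\<^sub>R u + \<alpha> *\<^sub>R v"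
  have "x \<in> open_sector u v" unfolding x_def open_sector_def using pos zero_less_one by blast
  moreover have "x \<in> open_sector w z" unfolding x_def e open_sector_def using pos by blast
  moreover have "x \<noteq> 0"
    using indep2_unit[OF unit_X[OF X(1)] unit_X[OF X(2)] ne(1,2)]
    unfolding x_def indep2_def by (metis zero_neq_one)
  ultimately have "x /\<^sub>R norm x \<in> sphere 0 1 \<inter> open_sector u v \<inter> (sphere 0 1 \<inter> open_sector w z)"
    using open_sector_normalize by simp
  then show ?L unfolding edge_interior_arc[OF X(1,2) ne(1,2)] edge_interior_arc[OF X(3,4) ne(3,4)] by blast
qed

text \<open>The same computation, solved for \<open>dir u\<close>. The coefficient of u may have
  either sign because the half-plane contains the whole line of u.\<close>

lemma crossing_half_iff:
  assumes X: "u \<in> S" "v \<in> X" "w \<in> X"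
    and ne: "w \<noteq> v" "w \<noteq> - v"
  shows "edge_interior {u, - u} \<inter> edge_interior {v, w} \<noteq> {} \<longleftrightarrow>
    (\<exists>\<alpha> \<beta> \<gamma>. 0 < \<beta> \<and> 0 < \<gamma> \<and> dir u = \<alpha> *\<^sub>R u + \<beta> *\<^sub>R v + \<gamma> *\<^sub>R w)"
    (is "?L \<longleftrightarrow> ?R")
proof
  assume ?L
  then have "open_half_plane u (dir u) \<inter> open_sector v w \<noteq> {}" using edge_interior_arc edge_interior_half assms by auto
  then obtain s t s' t' where e: "s *\<^sub>R u + t *\<^sub>R dir u = s' *\<^sub>R v + t' *\<^sub>R w"
    "0 < t" "0 < s'" "0 < t'"
    unfolding open_sector_def open_half_plane_def by auto
  then have "t *\<^sub>R dir u = (- s) *\<^sub>R u + s' *\<^sub>R v + t' *\<^sub>R w" by (simp add: algebra_simps)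
  also have "\<dots> = t *\<^sub>R ((- (s / t)) *\<^sub>R u + (s' / t) *\<^sub>R v + (t' / t) *\<^sub>R w)"
    using e by (simp add: scaleR_add_right scaleR_diff_right)
  finally have "dir u = (- (s / t)) *\<^sub>R u + (s' / t) *\<^sub>R v + (t' / t) *\<^sub>R w"
    using e by (simp del: scaleR_minus_left)
  moreover have "0 < s' / t" "0 < t' / t" using e by simp_all
  ultimately show ?R by blast
next
  assume ?R
  then obtain \<alpha> \<beta> \<gamma> where pos: "0 < \<beta>" "0 < \<gamma>" and "dir u = \<alpha> *\<^sub>R u + \<beta> *\<^sub>R v + \<gamma> *\<^sub>R w"
    by blast
  then have e: "(- \<alpha>) *\<^sub>R u + 1 *\<^sub>R dir u = \<beta> *\<^sub>R v + \<gamma> *\<^sub>R w" by (simp add: algebra_simps)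
  define x where "x = (- \<alpha>) *\<^sub>R u + 1 *\<^sub>R dir u"
  have "x \<in> open_half_plane u (dir u)" unfolding x_def open_half_plane_def using zero_less_one by blast
  moreover have "x \<in> open_sector v w" unfolding x_def e open_sector_def using pos by blast
  moreover have "x \<noteq> 0"
    using dir_nz(2)[OF X(1), of "- \<alpha>" 1] unfolding x_def by auto
  ultimately have "x /\<^sub>R norm x \<in> sphere 0 1 \<inter> open_half_plane u (dir u) \<inter> (sphere 0 1 \<inter> open_sector v w)"
    using open_sector_normalize open_half_plane_normalize by simp
  then show ?L unfolding edge_interior_half[OF X(1)] edge_interior_arc[OF X(2,3) ne] by blast
qed

lemma half_circles_disjoint:
  assumes "b \<in> P" "c \<in> P" "b \<noteq> c"
  shows "edge_interior {b, - b} \<inter> edge_interior {c, - c} = {}"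
proof (rule ccontr)
  assume "edge_interior {b, - b} \<inter> edge_interior {c, - c} \<noteq> {}"
  then obtain x where x: "x \<in> h {b, - b} - {b, - b}" "x \<in> h {c, - c} - {c, - c}"
    using D_antipodal assms by auto
  have "{b, - b} \<noteq> {c, - c}" using assms no_antipodes by (auto simp: doubleton_eq_iff)
  moreover have "{b, - b} \<in> antipodal_pairs P" "{c, - c} \<in> antipodal_pairs P"
    using assms by (auto simp: antipodal_pairs_def)
  ultimately have "({{b, - b}, {c, - c}}, x) \<in> crossings (antipodal_pairs P) h"
    using x unfolding crossings_def by blast
  then show False using nocross by simp
qed

text \<open>With a vanishing coordinate at v, the half-plane of u would contain w or - w. Both are
  vertices, so \<open>dir_avoid\<close> excludes this.\<close>

lemma dir_coord_nonzero:
  assumes "u \<in> S" "w \<in> S" "w \<noteq> u" "w \<noteq> - u" "dir u = \<alpha> *\<^sub>R u + \<beta> *\<^sub>R v + \<gamma> *\<^sub>R w"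
  shows "\<beta> \<noteq> 0"
proof
  assume "\<beta> = 0"
  then have d: "\<gamma> *\<^sub>R w = (- \<alpha>) *\<^sub>R u + 1 *\<^sub>R dir u" using assms(5) by simp
  have "\<gamma> \<noteq> 0"
  proof
    assume "\<gamma> = 0"
    then have "(- \<alpha>) *\<^sub>R u + 1 *\<^sub>R dir u = 0" using d by simp
    then show False using dir_nz(2)[OF assms(1)] by fastforce
  qed
  then obtain \<gamma>' w' where w': "0 < \<gamma>'" "w' = w \<or> w' = - w" "\<gamma> *\<^sub>R w = \<gamma>' *\<^sub>R w'"
    using signed_multiple by metis
  have "\<gamma>' *\<^sub>R w' = \<gamma>' *\<^sub>R ((- \<alpha> / \<gamma>') *\<^sub>R u + (1 / \<gamma>') *\<^sub>R dir u)"
    using d w' by (simp add: scaleR_add_right scaleR_diff_right)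
  then have "w' = (- \<alpha> / \<gamma>') *\<^sub>R u + (1 / \<gamma>') *\<^sub>R dir u" using w' by simp
  moreover have "0 \<le> 1 / \<gamma>'" using w' by simp
  ultimately have "w' \<in> closed_half_plane u (dir u)" unfolding closed_half_plane_def by blast
  moreover have "w' \<in> X" using w' assms S_uminus S_sub by auto
  moreover have "w' \<noteq> u" "w' \<noteq> - u" using w' assms by auto
  ultimately show False using dir_avoid assms(1) by blast
qed

text \<open>Here v may be an added point whose antipode is not a vertex. Positivity of \<beta>
  ensures that it is v itself, not - v, that would lie in the half-plane.\<close>

lemma dir_coord_pos_nonzero:
  assumes "u \<in> S" "v \<in> X" "v \<noteq> u" "v \<noteq> - u" "dir u = \<alpha> *\<^sub>R u + \<beta> *\<^sub>R v + \<gamma> *\<^sub>R w" "0 < \<beta>"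
  shows "\<gamma> \<noteq> 0"
proof
  assume "\<gamma> = 0"
  then have d: "\<beta> *\<^sub>R v = (- \<alpha>) *\<^sub>R u + 1 *\<^sub>R dir u" using assms(5) by simp
  then have "\<beta> *\<^sub>R v = \<beta> *\<^sub>R ((- \<alpha> / \<beta>) *\<^sub>R u + (1 / \<beta>) *\<^sub>R dir u)"
    using assms(6) by (simp add: scaleR_add_right scaleR_diff_right)
  then have "v = (- \<alpha> / \<beta>) *\<^sub>R u + (1 / \<beta>) *\<^sub>R dir u" using assms(6) by simp
  moreover have "0 \<le> 1 / \<beta>" using assms by simp
  ultimately have "v \<in> closed_half_plane u (dir u)" unfolding closed_half_plane_def by blast
  then show False using dir_avoid assms by blast
qed

text \<open>Equal signs of the two coordinates at \<open>v\<close> would make the half-circles at \<open>b\<close> and \<open>c\<close> cross.\<close>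

lemma dir_coords_opposite:
  assumes "b \<in> P" "c \<in> P" "b \<noteq> c"
    and b: "dir b = \<alpha> *\<^sub>R b + \<beta> *\<^sub>R v + \<gamma> *\<^sub>R c"
    and c: "dir c = \<alpha>' *\<^sub>R c + \<beta>' *\<^sub>R v + \<gamma>' *\<^sub>R b"
  shows "\<not> (0 < \<beta> \<and> 0 < \<beta>')" "\<not> (\<beta> < 0 \<and> \<beta>' < 0)"
proof -
  have "\<not> 0 < \<beta> * \<beta>'"
  proof
    assume pos: "0 < \<beta> * \<beta>'"
    then have nz: "0 < \<bar>\<beta>\<bar>" "0 < \<bar>\<beta>'\<bar>" by auto
    \<comment> \<open>The factors \<bar>\<beta>'\<bar> and \<bar>\<beta>\<bar> equalise the
      coordinates at v; adding s times b and t times c then makes the other coordinates agree,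
      giving a vector in both half-planes.\<close>
    define s where "s = \<bar>\<beta>\<bar> * \<gamma>' - \<bar>\<beta>'\<bar> * \<alpha>"
    define t where "t = \<bar>\<beta>'\<bar> * \<gamma> - \<bar>\<beta>\<bar> * \<alpha>'"
    have bb: "\<bar>\<beta>'\<bar> * \<beta> = \<bar>\<beta>\<bar> * \<beta>'"
      using pos by (auto simp: zero_less_mult_iff)
    have e: "s *\<^sub>R b + \<bar>\<beta>'\<bar> *\<^sub>R dir b = t *\<^sub>R c + \<bar>\<beta>\<bar> *\<^sub>R dir c"
      unfolding b c s_def t_def using bb by (simp add: algebra_simps)
    define x where "x = s *\<^sub>R b + \<bar>\<beta>'\<bar> *\<^sub>R dir b"
    have S: "b \<in> S" "c \<in> S" using assms S_sub by auto
    have "x \<in> open_half_plane b (dir b)" unfolding x_def open_half_plane_def using nz by blast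
    moreover have "x \<in> open_half_plane c (dir c)" unfolding x_def e open_half_plane_def using nz by blast
    moreover have "x \<noteq> 0" using dir_nz(2)[OF S(1), of s "\<bar>\<beta>'\<bar>"] nz unfolding x_def by auto
    ultimately have "x /\<^sub>R norm x \<in> edge_interior {b, - b} \<inter> edge_interior {c, - c}"
      using open_half_plane_normalize edge_interior_half S by simp
    then show False using half_circles_disjoint[OF assms(1-3)] by blast
  qed
  then show "\<not> (0 < \<beta> \<and> 0 < \<beta>')" "\<not> (\<beta> < 0 \<and> \<beta>' < 0)"
    by (auto simp: mult_neg_neg)
qed

text \<open>Arcs with a common endpoint or with antipodal endpoints do not meet in their interiors.
  This supplies the distinctness that \<open>indep_X\<close> asks for.\<close>

lemma crossing_arcs_general:
  assumes X: "u \<in> X" "v \<in> X" "w \<in> X" "z \<in> X"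
    and ne: "v \<noteq> u" "v \<noteq> - u" "z \<noteq> w" "z \<noteq> - w" "{u, v} \<noteq> {w, z}"
    and cross: "edge_interior {u, v} \<inter> edge_interior {w, z} \<noteq> {}"
  shows "w \<noteq> u" "w \<noteq> - u" "z \<noteq> u" "z \<noteq> - u" "w \<noteq> v" "w \<noteq> - v" "z \<noteq> v" "z \<noteq> - v"
proof -
  \<comment> \<open>One endpoint of each arc is compared at a time; reordering the two endpoint
    pairs gives all eight inequalities.\<close>
  have main: "w \<noteq> u \<and> w \<noteq> - u"
    if X: "u \<in> X" "v \<in> X" "w \<in> X" "z \<in> X"
      and ne: "v \<noteq> u" "v \<noteq> - u" "z \<noteq> w" "z \<noteq> - w" "{u, v} \<noteq> {w, z}"
      and cross: "edge_interior {u, v} \<inter> edge_interior {w, z} \<noteq> {}" for u v w z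
  proof -
    have 1: "w \<noteq> u"
      using edges_sharing_vertex[of u v z] that by auto
    moreover have "w \<noteq> - u"
    proof
      assume w: "w = - u"
      show False
      proof (cases "v = - u")
        case False
        have "z \<noteq> u" using that w by auto
        moreover have "z \<noteq> - u" using that w by auto
        ultimately show False
          using edges_at_antipodes[of u v z] that w by auto
      qed (use that in auto)
    qed
    ultimately show ?thesis ..
  qed
  have ne': "u \<noteq> v" "u \<noteq> - v" "w \<noteq> z" "w \<noteq> - z" using ne by auto
  have "{u, v} = {v, u}" "{w, z} = {z, w}" by auto
  then show "w \<noteq> u" "w \<noteq> - u" "z \<noteq> u" "z \<noteq> - u" "w \<noteq> v" "w \<noteq> - v" "z \<noteq> v" "z \<noteq> - v"
    using main[of u v w z] main[of u v z w] main[of v u w z] main[of v u z w] X ne ne' cross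
    by simp_all
qed

text \<open>The half-circle is an edge at u as well as at - u, so the result on edges with a shared
  vertex applies at both ends.\<close>

lemma crossing_half_general:
  assumes X: "u \<in> S" "v \<in> X" "w \<in> X" and ne: "w \<noteq> v" "w \<noteq> - v"
    and cross: "edge_interior {u, - u} \<inter> edge_interior {v, w} \<noteq> {}"
  shows "v \<noteq> u" "v \<noteq> - u" "w \<noteq> u" "w \<noteq> - u"
proof -
  have main: "v \<noteq> u \<and> v \<noteq> - u" 
    if X: "v \<in> X" "w \<in> X" and ne: "w \<noteq> v" "w \<noteq> - v"
    and cross: "edge_interior {u, - u} \<inter> edge_interior {v, w} \<noteq> {}" for v w
  proof -
    have uX: "u \<in> X" "- u \<in> X" using assms(1) S_uminus S_sub by auto
    have "v \<noteq> u"
      using edges_sharing_vertex[of u "- u" w] that uX neg_ne(2)[of u] by auto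
    moreover have "v \<noteq> - u"
      using edges_sharing_vertex[of "- u" u w] that uX neg_ne(1)[of u] by (auto simp: insert_commute)
    ultimately show ?thesis ..
  qed
  have "v \<noteq> w" "v \<noteq> - w" using ne by auto
  then show "v \<noteq> u" "v \<noteq> - u" "w \<noteq> u" "w \<noteq> - u"
    using main[of v w] main[of w v] assms by (simp_all add: insert_commute)
qed

section \<open>Two edges cross at most once\<close>

lemma crossing_point_unique_half:
  assumes "p \<in> P" "u \<in> X" "v \<in> X" "v \<noteq> u" "v \<noteq> - u"
    and xy: "x \<in> edge_interior {p, - p} \<inter> edge_interior {u, v}" "y \<in> edge_interior {p, - p} \<inter> edge_interior {u, v}"
  shows "x = y"
proof -
  have pS: "p \<in> S" "p \<in> X" using assms S_sub by auto
  have "u \<noteq> p" "u \<noteq> - p" "v \<noteq> p" "v \<noteq> - p"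
    using crossing_half_general[OF pS(1) assms(2-5)] xy by blast+
  then have ind: "indep3 p u v" using indep_X pS assms by metis
  obtain \<alpha> \<beta> \<gamma> where d: "dir p = \<alpha> *\<^sub>R p + \<beta> *\<^sub>R u + \<gamma> *\<^sub>R v"
    using indep3_coords[OF ind] by metis
  \<comment> \<open>Comparing coordinates in the basis p, u, v puts every common point on one ray,
    that of the part of \<open>dir p\<close> in the plane of u and v; a ray meets the sphere
    once.\<close>
  have "\<exists>t>0. x = t *\<^sub>R (\<beta> *\<^sub>R u + \<gamma> *\<^sub>R v) \<and> norm x = 1"
    if "x \<in> edge_interior {p, - p} \<inter> edge_interior {u, v}" for x
  proof -
    have "x \<in> open_half_plane p (dir p)" "x \<in> open_sector u v" "norm x = 1"
      using that edge_interior_half[OF pS(1)] edge_interior_arc[OF assms(2-5)] by auto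
    then obtain s t where x1: "x = s *\<^sub>R p + t *\<^sub>R dir p" "0 < t"
      unfolding open_half_plane_def by blast
    from \<open>x \<in> open_sector u v\<close> obtain s' t' where x2: "x = s' *\<^sub>R u + t' *\<^sub>R v"
      unfolding open_sector_def by blast
    note x = x1 x2
    have "(s + t * \<alpha>) *\<^sub>R p + (t * \<beta>) *\<^sub>R u + (t * \<gamma>) *\<^sub>R v = 0 *\<^sub>R p + s' *\<^sub>R u + t' *\<^sub>R v"
      using x(1) x(3) by (simp add: d algebra_simps)
    from indep3_eqD(2,3)[OF ind this] x \<open>norm x = 1\<close> show ?thesis
      by (intro exI[of _ t]) (simp add: scaleR_add_right)
  qed
  then obtain s t where "0 < s" "x = s *\<^sub>R (\<beta> *\<^sub>R u + \<gamma> *\<^sub>R v)" "norm x = 1"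
    "0 < t" "y = t *\<^sub>R (\<beta> *\<^sub>R u + \<gamma> *\<^sub>R v)" "norm y = 1"
    using xy by meson
  then show ?thesis using positive_multiples_unit_eq by metis
qed

lemma crossing_point_unique_arcs:
  assumes X: "u \<in> X" "v \<in> X" "w \<in> X" "z \<in> X"
    and ne: "v \<noteq> u" "v \<noteq> - u" "z \<noteq> w" "z \<noteq> - w" "{u, v} \<noteq> {w, z}"
    and xy: "x \<in> edge_interior {u, v} \<inter> edge_interior {w, z}" "y \<in> edge_interior {u, v} \<inter> edge_interior {w, z}"
  shows "x = y"
proof -
  note n4 = crossing_arcs_general[OF X ne]
  have "w \<noteq> u" "w \<noteq> - u" "w \<noteq> v" "w \<noteq> - v" using n4 xy by blast+
  then have ind: "indep3 u v w" using indep_X X ne by metis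
  obtain \<alpha> \<beta> \<gamma> where d: "z = \<alpha> *\<^sub>R u + \<beta> *\<^sub>R v + \<gamma> *\<^sub>R w"
    using indep3_coords[OF ind] by metis
  \<comment> \<open>Here the ray is spanned by the part of z in the plane of u and v.\<close>
  have "\<exists>t>0. x = t *\<^sub>R (\<alpha> *\<^sub>R u + \<beta> *\<^sub>R v) \<and> norm x = 1"
    if "x \<in> edge_interior {u, v} \<inter> edge_interior {w, z}" for x
  proof -
    have "x \<in> open_sector u v" "x \<in> open_sector w z" "norm x = 1"
      using that edge_interior_arc X ne by auto
    then obtain s t where x1: "x = s *\<^sub>R u + t *\<^sub>R v"
      unfolding open_sector_def by blast
    from \<open>x \<in> open_sector w z\<close> obtain s' t' where x2: "0 < t'" "x = s' *\<^sub>R w + t' *\<^sub>R z"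
      unfolding open_sector_def by blast
    note x = x1 x2
    have "(t' * \<alpha>) *\<^sub>R u + (t' * \<beta>) *\<^sub>R v + (s' + t' * \<gamma>) *\<^sub>R w = s *\<^sub>R u + t *\<^sub>R v + 0 *\<^sub>R w"
      using x(1) x(3) by (simp add: d algebra_simps)
    from indep3_eqD(1,2)[OF ind this] x \<open>norm x = 1\<close> show ?thesis
      by (intro exI[of _ t']) (simp add: scaleR_add_right)
  qed
  then obtain s t where "0 < s" "x = s *\<^sub>R (\<alpha> *\<^sub>R u + \<beta> *\<^sub>R v)" "norm x = 1"
    "0 < t" "y = t *\<^sub>R (\<alpha> *\<^sub>R u + \<beta> *\<^sub>R v)" "norm y = 1"
    using xy by meson
  then show ?thesis using positive_multiples_unit_eq by metis
qed

lemma crossing_point_unique: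
  assumes "e \<in> complete_edges X" "f \<in> complete_edges X" "e \<noteq> f"
    and xy: "x \<in> edge_interior e \<inter> edge_interior f" "y \<in> edge_interior e \<inter> edge_interior f"
  shows "x = y"
  using assms(1)
proof (cases rule: edge_cases)
  case e: (1 u v)
  show ?thesis using assms(2)
  proof (cases rule: edge_cases)
    case f: (1 w z)
    then show ?thesis
      using crossing_point_unique_arcs[OF e(2,3) f(2,3) e(4,5) f(4,5)] xy assms(3)
      unfolding e(1) f(1) by blast
  next
    case f: (2 p)
    then show ?thesis
      using crossing_point_unique_half[OF f(2) e(2-5)] xy unfolding e(1) f(1) by blast
  qed
next
  case e: (2 p)
  show ?thesis using assms(2)
  proof (cases rule: edge_cases)
    case f: (1 w z)
    then show ?thesis
      using crossing_point_unique_half[OF e(2) f(2-5)] xy unfolding e(1) f(1) by blast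
  next
    case f: (2 p')
    then have "p \<noteq> p'" using e assms by auto
    then show ?thesis using half_circles_disjoint[OF e(2) f(2)] xy unfolding e(1) f(1) by blast
  qed
qed

subsection \<open>Crossings at a vertex\<close>

text \<open>For u in S, the representative in P of the antipodal pair of u.\<close>

definition base :: "real^3 \<Rightarrow> real^3" where
  "base u = (if u \<in> P then u else - u)"

text \<open>Representatives of the antipodal pairs that do not contain q.\<close>

definition R :: "(real^3) set" where
  "R = {p \<in> P. p \<noteq> q \<and> p \<noteq> - q}"

lemma base_P: "p \<in> P \<Longrightarrow> base p = p" "p \<in> P \<Longrightarrow> base (- p) = p"
  using no_antipodes by (auto simp: base_def)

lemma base_in_P: "u \<in> S \<Longrightarrow> base u \<in> P"
  by (auto simp: base_def S_def)

lemma base_eqD: "base u = base v \<Longrightarrow> v = u \<or> v = - u"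
  by (auto simp: base_def split: if_splits)

lemma base_signed: "p \<in> P \<Longrightarrow> u = p \<or> u = - p \<Longrightarrow> base u = p"
  using base_P by auto

lemma in_S: "v \<in> X \<Longrightarrow> v \<noteq> q \<Longrightarrow> v \<in> S"
  by (auto simp: X_def)

lemma base_in_R: "v \<in> X \<Longrightarrow> v \<noteq> q \<Longrightarrow> v \<noteq> - q \<Longrightarrow> base v \<in> R"
  using base_in_P in_S by (auto simp: R_def base_def)

lemma R_signed:
  assumes "p \<in> R" "u = p \<or> u = - p"
  shows "u \<in> X" "u \<in> S" "u \<noteq> q" "u \<noteq> - q"
  using assms by (auto simp: R_def X_def S_def)

lemma R_distinct_signed:
  assumes "a \<in> R" "b \<in> R" "a \<noteq> b" "u = a \<or> u = - a" "v = b \<or> v = - b"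
  shows "v \<noteq> u" "v \<noteq> - u"
  using assms no_antipodes by (auto simp: R_def)

lemma q_X: "q \<in> X" by (simp add: X_def)

lemma fin_R: "finite R" using fin by (simp add: R_def)

text \<open>The crossings at q in combinatorial form. Two edges at q never cross, so F can be
  restricted to edges that avoid q.\<close>

definition incident :: "((real^3) \<times> (real^3) set) set" where
  "incident = {(v, F). v \<in> X - {q} \<and> F \<in> complete_edges (X - {q}) \<and> edge_interior {q, v} \<inter> edge_interior F \<noteq> {}}"

section \<open>The three types of crossing at q\<close>

definition arc_arc :: "((real^3) \<times> (real^3) set) set" where
  "arc_arc = {(v, F) \<in> incident. v \<noteq> - q \<and> F \<notin> antipodal_pairs P}"

definition arc_half :: "((real^3) \<times> (real^3) set) set" where
  "arc_half = {(v, F) \<in> incident. v \<noteq> - q \<and> F \<in> antipodal_pairs P}"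

definition half_arc :: "((real^3) \<times> (real^3) set) set" where
  "half_arc = {(v, F) \<in> incident. v = - q}"

lemma incident_edges:
  assumes "(v, F) \<in> incident"
  shows "v \<in> X" "v \<noteq> q" "F \<in> complete_edges X" "q \<notin> F" "F \<noteq> {q, v}"
  using assms by (auto simp: incident_def complete_edges_def)

lemma incidentI:
  assumes "v \<in> X" "v \<noteq> q" "x \<in> X" "y \<in> X" "x \<noteq> q" "y \<noteq> q" "y \<noteq> x"
    and "edge_interior {q, v} \<inter> edge_interior {x, y} \<noteq> {}"
  shows "(v, {x, y}) \<in> incident"
  using assms by (auto simp: incident_def complete_edges_def card_2_iff)

lemma arc_arc_elim:
  assumes "(v, F) \<in> arc_arc"
  obtains x y \<alpha> \<beta> \<gamma> where "F = {x, y}" "v \<in> X" "x \<in> X" "y \<in> X"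
    "v \<noteq> q" "v \<noteq> - q" "x \<noteq> q" "x \<noteq> - q" "y \<noteq> q" "y \<noteq> - q"
    "x \<noteq> v" "x \<noteq> - v" "y \<noteq> v" "y \<noteq> - v" "y \<noteq> x" "y \<noteq> - x"
    "0 < \<alpha>" "0 < \<beta>" "0 < \<gamma>" "q = \<alpha> *\<^sub>R (- v) + \<beta> *\<^sub>R x + \<gamma> *\<^sub>R y"
proof -
  have inc: "(v, F) \<in> incident" and v: "v \<noteq> - q" and F: "F \<notin> antipodal_pairs P"
    using assms by (auto simp: arc_arc_def)
  note i = incident_edges[OF inc]
  from i(3) show thesis
  proof (cases rule: edge_cases)
    case (1 x y)
    have c: "edge_interior {q, v} \<inter> edge_interior {x, y} \<noteq> {}" and ne: "{q, v} \<noteq> {x, y}"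
      using inc i 1 by (auto simp: incident_def)
    note g = crossing_arcs_general[OF q_X i(1) 1(2,3) i(2) v 1(4,5) ne c]
    obtain \<alpha> \<beta> \<gamma> where "0 < \<alpha>" "0 < \<beta>" "0 < \<gamma>" "q = (- \<alpha>) *\<^sub>R v + \<beta> *\<^sub>R x + \<gamma> *\<^sub>R y"
      using crossing_arcs_iff[OF q_X i(1) 1(2,3) i(2) v 1(4,5) g(1,2)] c by blast
    then show thesis using that[of x y \<alpha> \<beta> \<gamma>] 1 g i v by simp
  next
    case (2 p)
    then show thesis using F by (auto simp: antipodal_pairs_def)
  qed
qed

text \<open>Passing to antipodal pairs is a bijection onto the choices of a in \<open>R\<close> and
  of a two-element set in the rest. Its inverse expands q in the basis a, b, c: all coordinates are
  nonzero, and their signs determine the three endpoints.\<close>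

lemma card_arc_arc: "card arc_arc = card R * ((card R - 1) choose 2)"
proof -
  let ?f = "\<lambda>(v, F). (base v, base ` F)"
  let ?Y = "SIGMA a:R. {B. B \<subseteq> R - {a} \<and> card B = 2}"
  have "bij_betw ?f arc_arc ?Y"
    unfolding bij_betw_def
  proof
    show "inj_on ?f arc_arc"
    proof (rule inj_onI, clarify)
      fix v F v' F'
      assume m: "(v, F) \<in> arc_arc" "(v', F') \<in> arc_arc" and bv: "base v = base v'"
        and bF: "base ` F = base ` F'"
      from m(1) obtain x y \<alpha> \<beta> \<gamma> where F: "F = {x, y}"
        and X: "v \<in> X" "x \<in> X" "y \<in> X"
        and ne: "x \<noteq> v" "x \<noteq> - v" "y \<noteq> v" "y \<noteq> - v" "y \<noteq> x" "y \<noteq> - x"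
        and pos: "0 < \<alpha>" "0 < \<beta>" "0 < \<gamma>" and e: "q = \<alpha> *\<^sub>R (- v) + \<beta> *\<^sub>R x + \<gamma> *\<^sub>R y"
        by (rule arc_arc_elim) (rule that)
      have "indep3 v x y" using indep_X X ne by metis
      then have ind: "indep3 (- v) x y" by (rule indep3_minus)
      from m(2) obtain x' y' \<alpha>' \<beta>' \<gamma>' where F': "F' = {x', y'}"
        and pos': "0 < \<alpha>'" "0 < \<beta>'" "0 < \<gamma>'" and e': "q = \<alpha>' *\<^sub>R (- v') + \<beta>' *\<^sub>R x' + \<gamma>' *\<^sub>R y'"
        by (rule arc_arc_elim) (rule that)
      \<comment> \<open>This assumes that x' belongs to the pair of x and y' to that of y. Edges are
        unordered, so the opposite matching is treated by exchanging x' and y'.\<close>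
      have core: "v' = v \<and> {x', y'} = {x, y}" if "base x = base x'" "base y = base y'"
        and pos': "0 < \<alpha>'" "0 < \<beta>'" "0 < \<gamma>'" and e': "q = \<alpha>' *\<^sub>R (- v') + \<beta>' *\<^sub>R x' + \<gamma>' *\<^sub>R y'"
        for x' y' \<beta>' \<gamma>'
      proof -
        have s: "- v' = - v \<or> - v' = - (- v)" "x' = x \<or> x' = - x" "y' = y \<or> y' = - y"
          using base_eqD that(1,2) bv by fastforce+
        have eq: "\<alpha> *\<^sub>R (- v) + \<beta> *\<^sub>R x + \<gamma> *\<^sub>R y = \<alpha>' *\<^sub>R (- v') + \<beta>' *\<^sub>R x' + \<gamma>' *\<^sub>R y'"
          using e e' by simp
        show ?thesis
          using indep3_sign_unique[OF ind s eq pos(1) pos'(1)]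
            indep3_signs_unique[OF ind s eq pos(2) pos'(2) pos(3) pos'(3)] by simp
      qed
      have "{base x, base y} = {base x', base y'}" using bF F F' by simp
      then consider "base x = base x'" "base y = base y'" | "base x = base y'" "base y = base x'"
        by (auto simp: doubleton_eq_iff)
      then show "v = v' \<and> F = F'"
      proof cases
        case 1
        then show ?thesis using core[OF 1 pos' e'] F F' by simp
      next
        case 2
        have "q = \<alpha>' *\<^sub>R (- v') + \<gamma>' *\<^sub>R y' + \<beta>' *\<^sub>R x'" using e' by (simp add: algebra_simps)
        from core[OF 2 pos'(1,3,2) this] show ?thesis using F F' by (simp add: insert_commute)
      qed
    qed
    show "?f ` arc_arc = ?Y"
    proof (intro equalityI subsetI)
      fix z assume "z \<in> ?f ` arc_arc"
      then obtain v F where m: "(v, F) \<in> arc_arc" and z: "z = (base v, base ` F)" by auto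
      from m obtain x y where F: "F = {x, y}" "v \<in> X" "x \<in> X" "y \<in> X"
        and ne: "v \<noteq> q" "v \<noteq> - q" "x \<noteq> q" "x \<noteq> - q" "y \<noteq> q" "y \<noteq> - q"
          "x \<noteq> v" "x \<noteq> - v" "y \<noteq> v" "y \<noteq> - v" "y \<noteq> x" "y \<noteq> - x"
        by (rule arc_arc_elim) (rule that)
      have "base x \<noteq> base v" "base y \<noteq> base v" "base x \<noteq> base y"
        using base_eqD[of v x] base_eqD[of v y] base_eqD[of x y] ne by auto
      then show "z \<in> ?Y" using base_in_R F ne z by auto
    next
      fix z assume "z \<in> ?Y"
      then obtain a B where z: "z = (a, B)" "a \<in> R" "B \<subseteq> R - {a}" "card B = 2" by auto
      then obtain b c where B: "B = {b, c}" "b \<noteq> c" by (auto simp: card_2_iff)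
      have R: "a \<in> R" "b \<in> R" "c \<in> R" and ne: "a \<noteq> b" "a \<noteq> c" using z B by auto
      have P: "a \<in> P" "b \<in> P" "c \<in> P" using R by (auto simp: R_def)
      have iq: "indep3 q b c" "indep3 q c a" "indep3 q a b"
        using indep_X[OF q_X] R_signed R_distinct_signed R ne B(2) by metis+
      have abc: "indep3 a b c" using indep_P P ne B by blast
      obtain \<alpha> \<beta> \<gamma> where e: "q = \<alpha> *\<^sub>R a + \<beta> *\<^sub>R b + \<gamma> *\<^sub>R c"
        using indep3_coords[OF abc] by metis
      \<comment> \<open>A vanishing coordinate would express q by two of the three points, against
        \<open>iq\<close>.\<close>
      have "\<alpha> \<noteq> 0"
        using indep3_eqD(1)[OF iq(1), of 1 0 0 0 \<beta> \<gamma>] e by auto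
      moreover have "\<beta> \<noteq> 0"
        using indep3_eqD(1)[OF iq(2), of 1 0 0 0 \<gamma> \<alpha>] e by (auto simp: add.commute)
      moreover have "\<gamma> \<noteq> 0"
        using indep3_eqD(1)[OF iq(3), of 1 0 0 0 \<alpha> \<beta>] e by auto
      moreover obtain \<alpha>' w where "0 < \<alpha>'" "w = a \<or> w = - a" "\<alpha> *\<^sub>R a = \<alpha>' *\<^sub>R w"
        using signed_multiple[OF \<open>\<alpha> \<noteq> 0\<close>] by metis
      moreover obtain \<beta>' x where "0 < \<beta>'" "x = b \<or> x = - b" "\<beta> *\<^sub>R b = \<beta>' *\<^sub>R x"
        using signed_multiple[OF \<open>\<beta> \<noteq> 0\<close>] by metis
      moreover obtain \<gamma>' y where "0 < \<gamma>'" "y = c \<or> y = - c" "\<gamma> *\<^sub>R c = \<gamma>' *\<^sub>R y"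
        using signed_multiple[OF \<open>\<gamma> \<noteq> 0\<close>] by metis
      ultimately have pos: "0 < \<alpha>'" "0 < \<beta>'" "0 < \<gamma>'"
        and s: "w = a \<or> w = - a" "x = b \<or> x = - b" "y = c \<or> y = - c"
        and m: "\<alpha> *\<^sub>R a = \<alpha>' *\<^sub>R w" "\<beta> *\<^sub>R b = \<beta>' *\<^sub>R x" "\<gamma> *\<^sub>R c = \<gamma>' *\<^sub>R y"
        by blast+
      \<comment> \<open>The sign is reversed because \<open>crossing_arcs_iff\<close> has a negative
        coefficient at v.\<close>
      define v where "v = - w"
      have sv: "v = a \<or> v = - a" using s by (auto simp: v_def)
      have e': "q = (- \<alpha>') *\<^sub>R v + \<beta>' *\<^sub>R x + \<gamma>' *\<^sub>R y"
        using e m by (simp add: v_def)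
      note X = R_signed[OF R(1) sv] R_signed[OF R(2) s(2)] R_signed[OF R(3) s(3)]
      note d = R_distinct_signed[OF R(2,3) B(2) s(2,3)]
      have "edge_interior {q, v} \<inter> edge_interior {x, y} \<noteq> {}"
        using crossing_arcs_iff[OF q_X X(1,5,9) X(3,4) d X(7,8)] pos e' by blast
      then have "(v, {x, y}) \<in> incident"
        by (intro incidentI X d)
      then have "(v, {x, y}) \<in> arc_arc"
        using X(4) not_antipodal_pair[OF d(2)] by (simp add: arc_arc_def)
      moreover have "?f (v, {x, y}) = z"
        using base_signed[OF P(1) sv] base_signed[OF P(2) s(2)] base_signed[OF P(3) s(3)] z(1) B
        by simp
      ultimately show "z \<in> ?f ` arc_arc" by (rule rev_image_eqI[OF _ sym])
    qed
  qed
  then have "card arc_arc = card ?Y" by (rule bij_betw_same_card)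
  also have "\<dots> = (\<Sum>a\<in>R. card {B. B \<subseteq> R - {a} \<and> card B = 2})"
    using fin_R by (intro card_SigmaI) auto
  also have "\<dots> = (\<Sum>a\<in>R. (card R - 1) choose 2)"
    using fin_R by (intro sum.cong) (simp_all add: n_subsets)
  finally show ?thesis by simp
qed

lemma arc_half_elim:
  assumes "(v, F) \<in> arc_half"
  obtains c \<alpha> \<beta> \<gamma> where "F = {c, - c}" "v \<in> X" "c \<in> P"
    "v \<noteq> q" "v \<noteq> - q" "c \<noteq> q" "c \<noteq> - q" "v \<noteq> c" "v \<noteq> - c"
    "0 < \<beta>" "0 < \<gamma>" "dir c = \<alpha> *\<^sub>R c + \<beta> *\<^sub>R q + \<gamma> *\<^sub>R v"
proof -
  have inc: "(v, F) \<in> incident" and v: "v \<noteq> - q" and F: "F \<in> antipodal_pairs P"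
    using assms by (auto simp: arc_half_def)
  note i = incident_edges[OF inc]
  from F obtain c where c: "F = {c, - c}" "c \<in> P" by (auto simp: antipodal_pairs_def)
  have cS: "c \<in> S" using c S_sub by blast
  have x: "edge_interior {c, - c} \<inter> edge_interior {q, v} \<noteq> {}" using inc c by (auto simp: incident_def)
  note g = crossing_half_general[OF cS q_X i(1,2) v x]
  obtain \<alpha> \<beta> \<gamma> where "0 < \<beta>" "0 < \<gamma>" "dir c = \<alpha> *\<^sub>R c + \<beta> *\<^sub>R q + \<gamma> *\<^sub>R v"
    using crossing_half_iff[OF cS q_X i(1,2) v] x by blast
  moreover have "c \<noteq> q" "c \<noteq> - q" using g(1,2) by auto
  ultimately show thesis using that[of c \<beta> \<gamma> \<alpha>] c g(3,4) i(1,2) v by blast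
qed

text \<open>Once the coordinate at q is positive, the sign of the coordinate at b selects which of b
  and - b is the endpoint of the crossing arc from q.\<close>

lemma arc_half_exists:
  assumes R: "b \<in> R" "c \<in> R" "b \<noteq> c"
    and d: "dir c = \<alpha> *\<^sub>R c + \<beta> *\<^sub>R q + \<gamma> *\<^sub>R b" "0 < \<beta>"
  shows "\<exists>v. (v, {c, - c}) \<in> arc_half \<and> (v = b \<or> v = - b)"
proof -
  have cS: "c \<in> S" and cP: "c \<in> P" using R_signed[OF R(2)] R by (auto simp: R_def)
  have "q \<noteq> c" "q \<noteq> - c" using R_signed[OF R(2), of c] by auto
  then have "\<gamma> \<noteq> 0" using dir_coord_pos_nonzero[OF cS q_X _ _ d] by blast
  then obtain \<gamma>' v where v: "0 < \<gamma>'" "v = b \<or> v = - b" "\<gamma> *\<^sub>R b = \<gamma>' *\<^sub>R v"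
    using signed_multiple by metis
  note vX = R_signed[OF R(1) v(2)]
  have "dir c = \<alpha> *\<^sub>R c + \<beta> *\<^sub>R q + \<gamma>' *\<^sub>R v" using d v by simp
  then have "edge_interior {c, - c} \<inter> edge_interior {q, v} \<noteq> {}"
    using crossing_half_iff[OF cS q_X vX(1,3,4)] d(2) v(1) by blast
  then have "(v, {c, - c}) \<in> incident"
    using incidentI[of v c "- c"] vX R_signed[OF R(2), of c] R_signed[OF R(2), of "- c"]
      neg_ne[of c] by blast
  then show ?thesis using vX v(2) cP by (auto simp: arc_half_def antipodal_pairs_def)
qed

text \<open>For a pair {b, c}, the q-coordinates of \<open>dir b\<close> and \<open>dir c\<close>
  are nonzero with opposite signs. That they are not both positive gives injectivity, that they are
  not both negative gives surjectivity.\<close>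

lemma card_arc_half: "card arc_half = card R choose 2"
proof -
  let ?f = "\<lambda>(v, F). insert (base v) (base ` F)"
  let ?Y = "{B. B \<subseteq> R \<and> card B = 2}"
  have "bij_betw ?f arc_half ?Y"
    unfolding bij_betw_def
  proof
    show "inj_on ?f arc_half"
    proof (rule inj_onI, clarify)
      fix v F v' F'
      assume m: "(v, F) \<in> arc_half" "(v', F') \<in> arc_half"
        and b: "insert (base v) (base ` F) = insert (base v') (base ` F')"
      from m(1) obtain c \<alpha> \<beta> \<gamma> where F: "F = {c, - c}" "v \<in> X" "c \<in> P"
        and ne: "v \<noteq> q" "v \<noteq> - q" "c \<noteq> q" "c \<noteq> - q" "v \<noteq> c" "v \<noteq> - c"
        and pos: "0 < \<beta>" "0 < \<gamma>" and e: "dir c = \<alpha> *\<^sub>R c + \<beta> *\<^sub>R q + \<gamma> *\<^sub>R v"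
        by (rule arc_half_elim) (rule that)
      from m(2) obtain c' \<alpha>' \<beta>' \<gamma>' where F': "F' = {c', - c'}" "v' \<in> X" "c' \<in> P"
        and ne': "v' \<noteq> q" "v' \<noteq> - q" "v' \<noteq> c'" "v' \<noteq> - c'"
        and pos': "0 < \<beta>'" "0 < \<gamma>'" and e': "dir c' = \<alpha>' *\<^sub>R c' + \<beta>' *\<^sub>R q + \<gamma>' *\<^sub>R v'"
        by (rule arc_half_elim) (rule that)
      have "{base v, c} = {base v', c'}" using b F F' base_P by simp
      then consider "c = c'" "base v = base v'" | "c \<noteq> c'" "base v = c'" "base v' = c"
        by (cases "c = c'") (auto simp: doubleton_eq_iff)
      then show "v = v' \<and> F = F'"
      proof cases
        case 1
        have "q \<noteq> c" "q \<noteq> - c" using ne by auto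
        from indep_X[OF S_sub(2)[OF F(3)] q_X F(2) this ne(5,6,1,2)] have ind: "indep3 c q v" .
        have "v' = v \<or> v' = - v" using base_eqD 1 by blast
        moreover have "\<alpha> *\<^sub>R c + \<beta> *\<^sub>R q + \<gamma> *\<^sub>R v = \<alpha>' *\<^sub>R c + \<beta>' *\<^sub>R q + \<gamma>' *\<^sub>R v'"
          using e e' 1 by simp
        ultimately have "v' = v"
          using indep3_signs_unique(2)[OF ind] pos pos' by blast
        then show ?thesis using F F' 1 by simp
      next
        case 2
        \<comment> \<open>The two elements would come from the half-circles at c and at c'
          respectively, each with a positive coordinate at q.\<close>
        have "v = c' \<or> v = - c'" "v' = c \<or> v' = - c"
          using base_eqD[of c' v] base_eqD[of c v'] base_P F F' 2 by auto
        then obtain \<delta> \<delta>' where "\<gamma> *\<^sub>R v = \<delta> *\<^sub>R c'" "\<gamma>' *\<^sub>R v' = \<delta>' *\<^sub>R c"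
          by (metis scaleR_minus_left scaleR_minus_right)
        then show ?thesis
          using dir_coords_opposite(1)[OF F(3) F'(3) 2(1), of \<alpha> \<beta> q \<delta> \<alpha>' \<beta>' \<delta>'] e e' pos pos' by simp
      qed
    qed
    show "?f ` arc_half = ?Y"
    proof (intro equalityI subsetI)
      fix z assume "z \<in> ?f ` arc_half"
      then obtain v F where m: "(v, F) \<in> arc_half" and z: "z = insert (base v) (base ` F)" by auto
      from m obtain c where F: "F = {c, - c}" "v \<in> X" "c \<in> P"
        and ne: "v \<noteq> q" "v \<noteq> - q" "c \<noteq> q" "c \<noteq> - q" "v \<noteq> c" "v \<noteq> - c"
        by (rule arc_half_elim) (rule that)
      have "base v \<noteq> c" using base_eqD[of c v] base_P F ne by auto
      moreover have "z = {base v, c}" using z F base_P by simp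
      moreover have "c \<in> R" using F ne by (simp add: R_def)
      ultimately show "z \<in> ?Y" using base_in_R F ne by simp
    next
      fix z assume "z \<in> ?Y"
      then obtain b c where z: "z = {b, c}" "b \<noteq> c" "b \<in> R" "c \<in> R" by (auto simp: card_2_iff)
      have P: "b \<in> P" "c \<in> P" using z by (auto simp: R_def)
      have S: "b \<in> S" "c \<in> S" using P S_sub by auto
      have iq: "indep3 q b c"
        using indep_X[OF q_X] R_signed R_distinct_signed z by metis
      obtain \<beta> \<alpha> \<gamma> where b: "dir b = \<beta> *\<^sub>R q + \<alpha> *\<^sub>R b + \<gamma> *\<^sub>R c"
        using indep3_coords[OF iq] by metis
      then have b: "dir b = \<alpha> *\<^sub>R b + \<beta> *\<^sub>R q + \<gamma> *\<^sub>R c" by (simp add: algebra_simps)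
      obtain \<beta>' \<alpha>' \<gamma>' where c: "dir c = \<beta>' *\<^sub>R q + \<gamma>' *\<^sub>R b + \<alpha>' *\<^sub>R c"
        using indep3_coords[OF iq] by metis
      then have c: "dir c = \<alpha>' *\<^sub>R c + \<beta>' *\<^sub>R q + \<gamma>' *\<^sub>R b" by (simp add: algebra_simps)
      have bc: "c \<noteq> - b" "b \<noteq> - c" using R_distinct_signed z by metis+
      have "\<beta> \<noteq> 0" using dir_coord_nonzero[OF S _ _ b] z bc by auto
      moreover have "\<beta>' \<noteq> 0" using dir_coord_nonzero[OF S(2,1) _ _ c] z bc by auto
      ultimately have "0 < \<beta> \<or> 0 < \<beta>'"
        using dir_coords_opposite(2)[OF P z(2) b c] by linarith
      then have "\<exists>v a a'. (v, {a, - a}) \<in> arc_half \<and> (v = a' \<or> v = - a') \<and> {a', a} = {b, c} \<and> a \<in> P \<and> a' \<in> P"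
      proof
        assume "0 < \<beta>"
        then show ?thesis using arc_half_exists[OF z(4,3) _ b] z(2) P by blast
      next
        assume "0 < \<beta>'"
        then show ?thesis using arc_half_exists[OF z(3,4) _ c] z(2) P by blast
      qed
      then obtain v a a' where a: "(v, {a, - a}) \<in> arc_half" "v = a' \<or> v = - a'" "{a', a} = {b, c}"
        "a \<in> P" "a' \<in> P" by blast
      have "?f (v, {a, - a}) = z"
        using base_signed[OF a(5,2)] base_P[OF a(4)] a(3) z(1) by simp
      then show "z \<in> ?f ` arc_half" by (rule rev_image_eqI[OF a(1) sym])
    qed
  qed
  then have "card arc_half = card ?Y" by (rule bij_betw_same_card)
  then show ?thesis using fin_R by (simp add: n_subsets)
qed

lemma half_arc_elim:
  assumes "(v, F) \<in> half_arc"
  obtains x y \<alpha> \<beta> \<gamma> where "q \<in> S" "v = - q" "F = {x, y}" "x \<in> X" "y \<in> X"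
    "x \<noteq> q" "x \<noteq> - q" "y \<noteq> q" "y \<noteq> - q" "y \<noteq> x" "y \<noteq> - x"
    "0 < \<beta>" "0 < \<gamma>" "dir q = \<alpha> *\<^sub>R q + \<beta> *\<^sub>R x + \<gamma> *\<^sub>R y"
proof -
  have inc: "(v, F) \<in> incident" and v: "v = - q"
    using assms by (auto simp: half_arc_def)
  note i = incident_edges[OF inc]
  have qS: "q \<in> S" using S_if_antipodes q_X i v by blast
  have x: "edge_interior {q, - q} \<inter> edge_interior F \<noteq> {}" using inc v by (auto simp: incident_def)
  from i(3) show thesis
  proof (cases rule: edge_cases)
    case (1 x y)
    have c: "edge_interior {q, - q} \<inter> edge_interior {x, y} \<noteq> {}" using x 1 by simp
    note g = crossing_half_general[OF qS 1(2-5) c]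
    obtain \<alpha> \<beta> \<gamma> where "0 < \<beta>" "0 < \<gamma>" "dir q = \<alpha> *\<^sub>R q + \<beta> *\<^sub>R x + \<gamma> *\<^sub>R y"
      using crossing_half_iff[OF qS 1(2-5)] c by blast
    then show thesis using that[of x y \<beta> \<gamma> \<alpha>] 1 g qS v by simp
  next
    case (2 p)
    \<comment> \<open>The half-circle at q is rewritten through its representative in P, since
      \<open>half_circles_disjoint\<close> concerns points of P.\<close>
    have "{q, - q} = {base q, - base q}" by (auto simp: base_def)
    moreover have "p \<noteq> base q" using i(4) 2 by (auto simp: base_def)
    ultimately show thesis
      using half_circles_disjoint[OF base_in_P[OF qS] 2(2)] x 2 by auto
  qed
qed

text \<open>The coordinates of \<open>dir q\<close> at b and c are nonzero, and their signs single
  out one of the four arcs between the two pairs.\<close>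

lemma card_half_arc:
  assumes qS: "q \<in> S"
  shows "card half_arc = card R choose 2"
proof -
  let ?f = "\<lambda>(v, F). base ` F"
  let ?Y = "{B. B \<subseteq> R \<and> card B = 2}"
  have "bij_betw ?f half_arc ?Y"
    unfolding bij_betw_def
  proof
    show "inj_on ?f half_arc"
    proof (rule inj_onI, clarify)
      fix v F v' F'
      assume m: "(v, F) \<in> half_arc" "(v', F') \<in> half_arc" and bF: "base ` F = base ` F'"
      from m(1) obtain x y \<alpha> \<beta> \<gamma> where v: "v = - q" and F: "F = {x, y}"
        and X: "x \<in> X" "y \<in> X"
        and ne: "x \<noteq> q" "x \<noteq> - q" "y \<noteq> q" "y \<noteq> - q" "y \<noteq> x" "y \<noteq> - x"
        and pos: "0 < \<beta>" "0 < \<gamma>" and e: "dir q = \<alpha> *\<^sub>R q + \<beta> *\<^sub>R x + \<gamma> *\<^sub>R y"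
        by (rule half_arc_elim) (rule that)
      have ind: "indep3 q x y" using indep_X[OF q_X] X ne by metis
      from m(2) obtain x' y' \<alpha>' \<beta>' \<gamma>' where v': "v' = - q" and F': "F' = {x', y'}"
        and pos': "0 < \<beta>'" "0 < \<gamma>'" and e': "dir q = \<alpha>' *\<^sub>R q + \<beta>' *\<^sub>R x' + \<gamma>' *\<^sub>R y'"
        by (rule half_arc_elim) (rule that)
      have core: "{x', y'} = {x, y}" if "base x = base x'" "base y = base y'"
        and pos': "0 < \<beta>'" "0 < \<gamma>'" and e': "dir q = \<alpha>' *\<^sub>R q + \<beta>' *\<^sub>R x' + \<gamma>' *\<^sub>R y'"
        for x' y' \<beta>' \<gamma>'
      proof -
        have s: "q = q \<or> q = - q" "x' = x \<or> x' = - x" "y' = y \<or> y' = - y"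
          using base_eqD that(1,2) by blast+
        have eq: "\<alpha> *\<^sub>R q + \<beta> *\<^sub>R x + \<gamma> *\<^sub>R y = \<alpha>' *\<^sub>R q + \<beta>' *\<^sub>R x' + \<gamma>' *\<^sub>R y'"
          using e e' by simp
        show ?thesis
          using indep3_signs_unique[OF ind s eq pos(1) pos'(1) pos(2) pos'(2)] by simp
      qed
      have "{base x, base y} = {base x', base y'}" using bF F F' by simp
      then consider "base x = base x'" "base y = base y'" | "base x = base y'" "base y = base x'"
        by (auto simp: doubleton_eq_iff)
      then show "v = v' \<and> F = F'"
      proof cases
        case 1
        then show ?thesis using core[OF 1 pos' e'] F F' v v' by simp
      next
        case 2
        have "dir q = \<alpha>' *\<^sub>R q + \<gamma>' *\<^sub>R y' + \<beta>' *\<^sub>R x'" using e' by (simp add: algebra_simps)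
        from core[OF 2 pos'(2,1) this] show ?thesis using F F' v v' by (simp add: insert_commute)
      qed
    qed
    show "?f ` half_arc = ?Y"
    proof (intro equalityI subsetI)
      fix z assume "z \<in> ?f ` half_arc"
      then obtain v F where m: "(v, F) \<in> half_arc" and z: "z = base ` F" by auto
      from m obtain x y where F: "F = {x, y}" "x \<in> X" "y \<in> X"
        and ne: "x \<noteq> q" "x \<noteq> - q" "y \<noteq> q" "y \<noteq> - q" "y \<noteq> x" "y \<noteq> - x"
        by (rule half_arc_elim) (rule that)
      have "base x \<noteq> base y" using base_eqD[of x y] ne by auto
      then show "z \<in> ?Y" using base_in_R F ne z by auto
    next
      fix z assume "z \<in> ?Y"
      then obtain b c where z: "z = {b, c}" "b \<noteq> c" "b \<in> R" "c \<in> R" by (auto simp: card_2_iff)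
      have P: "b \<in> P" "c \<in> P" using z by (auto simp: R_def)
      have S: "b \<in> S" "c \<in> S" using P S_sub by auto
      have iq: "indep3 q b c"
        using indep_X[OF q_X] R_signed R_distinct_signed z by metis
      obtain \<alpha> \<beta> \<gamma> where e: "dir q = \<alpha> *\<^sub>R q + \<beta> *\<^sub>R b + \<gamma> *\<^sub>R c"
        using indep3_coords[OF iq] by metis
      then have e2: "dir q = \<alpha> *\<^sub>R q + \<gamma> *\<^sub>R c + \<beta> *\<^sub>R b" by (simp add: algebra_simps)
      have bc: "b \<noteq> q" "b \<noteq> - q" "c \<noteq> q" "c \<noteq> - q" using R_signed z by blast+
      have "\<beta> \<noteq> 0" "\<gamma> \<noteq> 0"
        using dir_coord_nonzero[OF qS S(2) _ _ e] dir_coord_nonzero[OF qS S(1) _ _ e2] bc by auto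
      obtain \<beta>' x where x: "0 < \<beta>'" "x = b \<or> x = - b" "\<beta> *\<^sub>R b = \<beta>' *\<^sub>R x"
        using signed_multiple[OF \<open>\<beta> \<noteq> 0\<close>] by metis
      obtain \<gamma>' y where y: "0 < \<gamma>'" "y = c \<or> y = - c" "\<gamma> *\<^sub>R c = \<gamma>' *\<^sub>R y"
        using signed_multiple[OF \<open>\<gamma> \<noteq> 0\<close>] by metis
      note pos = x(1) y(1) and s = x(2) y(2) and m = x(3) y(3)
      have e': "dir q = \<alpha> *\<^sub>R q + \<beta>' *\<^sub>R x + \<gamma>' *\<^sub>R y" using e m by simp
      note X = R_signed[OF z(3) s(1)] R_signed[OF z(4) s(2)]
      note d = R_distinct_signed[OF z(3,4,2) s]
      have "edge_interior {q, - q} \<inter> edge_interior {x, y} \<noteq> {}"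
        using crossing_half_iff[OF qS X(1,5) d] pos e' by blast
      then have "(- q, {x, y}) \<in> incident"
        by (intro incidentI X d S_sub(1)[OF S_uminus[OF qS]] neg_ne(2)[OF q_X])
      then have "(- q, {x, y}) \<in> half_arc"
        by (simp add: half_arc_def)
      moreover have "?f (- q, {x, y}) = z"
        using base_signed[OF P(1) s(1)] base_signed[OF P(2) s(2)] z(1) by simp
      ultimately show "z \<in> ?f ` half_arc" by (rule rev_image_eqI[OF _ sym])
    qed
  qed
  then have "card half_arc = card ?Y" by (rule bij_betw_same_card)
  then show ?thesis using fin_R by (simp add: n_subsets)
qed

lemma card_incident:
  "card incident = card R * ((card R - 1) choose 2) + (card R choose 2) + (if q \<in> S then card R choose 2 else 0)"
proof -
  have "incident \<subseteq> X \<times> Pow X" by (auto simp: incident_def complete_edges_def)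
  then have f: "finite incident" using fin_X by (meson finite_SigmaI finite_Pow_iff finite_subset)
  have "incident = arc_arc \<union> arc_half \<union> half_arc"
    by (auto simp: arc_arc_def arc_half_def half_arc_def)
  moreover have "finite arc_arc" "finite arc_half" "finite half_arc"
    using f by (auto simp: arc_arc_def arc_half_def half_arc_def elim: finite_subset[rotated])
  moreover have "arc_arc \<inter> arc_half = {}" "(arc_arc \<union> arc_half) \<inter> half_arc = {}"
    by (auto simp: arc_arc_def arc_half_def half_arc_def)
  ultimately have "card incident = card arc_arc + card arc_half + card half_arc"
    by (simp add: card_Un_disjoint)
  moreover have "half_arc = {}" if "q \<notin> S"
    using half_arc_elim that by (metis ex_in_conv surj_pair)
  ultimately show ?thesis using card_arc_arc card_arc_half card_half_arc by auto
qed

section \<open>From the crossings at one vertex to all crossings\<close>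

abbreviation crossings_on :: "(real^3) set \<Rightarrow> ((real^3) set set \<times> (real^3)) set" where
  "crossings_on V \<equiv> crossings (complete_edges V) D"

text \<open>Edges with a common endpoint do not cross, so s lies on only one of the two edges; since
  the pair of edges is unordered, that edge can be listed first.\<close>

lemma crossing_at_vertex:
  assumes "c \<in> crossings_on X" "s \<in> \<Union>(fst c)"
  obtains v F x where "c = ({{s, v}, F}, x)" "s \<in> X" "v \<in> X" "v \<noteq> s" "F \<in> complete_edges (X - {s})"
    "x \<in> edge_interior {s, v} \<inter> edge_interior F"
proof -
  note result = that
  obtain e f x where c: "c = ({e, f}, x)" and ef: "e \<in> complete_edges X" "f \<in> complete_edges X" "e \<noteq> f"
    and x: "x \<in> edge_interior e" "x \<in> edge_interior f"
    using assms(1) unfolding crossings_def by blast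
  have main: thesis
    if c: "c = ({e, f}, x)" and ef: "e \<in> complete_edges X" "f \<in> complete_edges X" "e \<noteq> f"
    and x: "x \<in> edge_interior e" "x \<in> edge_interior f" and s: "s \<in> e" for e f
  proof -
    have "card e = 2" "e \<subseteq> X" using ef by (auto simp: complete_edges_def)
    with s obtain v where v: "e = {s, v}" "v \<noteq> s" "s \<in> X" "v \<in> X"
      unfolding card_2_iff by auto
    have "s \<notin> f"
    proof
      assume "s \<in> f"
      moreover have "card f = 2" "f \<subseteq> X" using ef by (auto simp: complete_edges_def)
      ultimately obtain w where w: "f = {s, w}" "w \<noteq> s" "w \<in> X"
        unfolding card_2_iff by auto
      then have "v \<noteq> w" using v ef by auto
      then show False using edges_sharing_vertex[of s v w] v w x by auto
    qed
    then have "f \<in> complete_edges (X - {s})" using ef by (auto simp: complete_edges_def)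
    then show thesis using result[of v f x] c v x by auto
  qed
  have "s \<in> e \<or> s \<in> f" using assms(2) c by auto
  then show thesis using main[OF c ef x] main[of f e] c ef x by (metis insert_commute)
qed

text \<open>Two edges cross at most once, so a crossing is determined by its pair of edges, and
  there are finitely many pairs.\<close>

lemma finite_crossings_on: "finite (crossings_on X)"
proof -
  have "inj_on fst (crossings_on X)"
  proof (rule inj_onI)
    fix c c' assume m: "c \<in> crossings_on X" "c' \<in> crossings_on X" "fst c = fst c'"
    obtain e f x where c: "c = ({e, f}, x)" and ef: "e \<in> complete_edges X" "f \<in> complete_edges X" "e \<noteq> f"
      and x: "x \<in> edge_interior e" "x \<in> edge_interior f"
      using m(1) unfolding crossings_def by blast
    obtain e' f' x' where c': "c' = ({e', f'}, x')" and x': "x' \<in> edge_interior e'" "x' \<in> edge_interior f'"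
      using m(2) unfolding crossings_def by blast
    have "{e, f} = {e', f'}" using m c c' by simp
    then have "x' \<in> edge_interior e" "x' \<in> edge_interior f" using x' by (auto simp: doubleton_eq_iff)
    then have "x = x'" using crossing_point_unique[OF ef] x by blast
    then show "c = c'" using c c' m by simp
  qed
  moreover have "fst ` crossings_on X \<subseteq> Pow (Pow X)"
    unfolding crossings_def complete_edges_def by auto
  then have "finite (fst ` crossings_on X)" using fin_X by (meson finite_Pow_iff finite_subset)
  ultimately show ?thesis using finite_imageD by blast
qed

text \<open>Uniqueness of the crossing point makes the point selected by \<open>SOME\<close> the
  actual one, so the pairs in \<open>incident\<close> correspond exactly to crossings.\<close>

lemma card_crossings_at: "card {c \<in> crossings_on X. q \<in> \<Union>(fst c)} = card incident"
proof -
  let ?x = "\<lambda>v F. SOME x. x \<in> edge_interior {q, v} \<inter> edge_interior F"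
  let ?f = "\<lambda>(v, F). ({{q, v}, F}, ?x v F)"
  have some: "?x v F \<in> edge_interior {q, v} \<inter> edge_interior F" if "(v, F) \<in> incident" for v F
    using that someI_ex[of "\<lambda>x. x \<in> edge_interior {q, v} \<inter> edge_interior F"] unfolding incident_def by blast
  have qv: "{q, v} \<in> complete_edges X" if "v \<in> X" "v \<noteq> q" for v
    using that q_X by (auto simp: complete_edges_def)
  have "bij_betw ?f incident {c \<in> crossings_on X. q \<in> \<Union>(fst c)}"
    unfolding bij_betw_def
  proof
    show "inj_on ?f incident"
    proof (rule inj_onI, clarify)
      fix v F v' F'
      assume m: "(v, F) \<in> incident" "(v', F') \<in> incident"
        and e: "{{q, v}, F} = {{q, v'}, F'}"
      have "q \<notin> F" "q \<notin> F'" using incident_edges m by blast+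
      then have "{q, v} \<noteq> F'" "F = F'" "{q, v} = {q, v'}" using e by (auto simp: doubleton_eq_iff)
      then show "v = v' \<and> F = F'" by (auto simp: doubleton_eq_iff)
    qed
    show "?f ` incident = {c \<in> crossings_on X. q \<in> \<Union>(fst c)}"
    proof (intro equalityI subsetI)
      fix c assume "c \<in> ?f ` incident"
      then obtain v F where m: "(v, F) \<in> incident" and c: "c = ({{q, v}, F}, ?x v F)" by auto
      note i = incident_edges[OF m]
      have "c \<in> crossings_on X"
        unfolding c using some[OF m] by (intro crossingsI[OF qv[OF i(1,2)] i(3) i(5)[symmetric]]) blast+
      then show "c \<in> {c \<in> crossings_on X. q \<in> \<Union>(fst c)}" using c by simp
    next
      fix c assume "c \<in> {c \<in> crossings_on X. q \<in> \<Union>(fst c)}"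
      then have "c \<in> crossings_on X" "q \<in> \<Union>(fst c)" by auto
      then obtain v F x where c: "c = ({{q, v}, F}, x)" "v \<in> X" "v \<noteq> q" "F \<in> complete_edges (X - {q})"
        and x: "x \<in> edge_interior {q, v} \<inter> edge_interior F"
        by (rule crossing_at_vertex) (rule that)
      then have m: "(v, F) \<in> incident" by (auto simp: incident_def)
      note i = incident_edges[OF m]
      have "x = ?x v F"
        using crossing_point_unique[OF qv[OF i(1,2)] i(3) i(5)[symmetric] x some[OF m]] .
      then have "c = ?f (v, F)" using c by simp
      then show "c \<in> ?f ` incident" using m by (rule image_eqI)
    qed
  qed
  from bij_betw_same_card[OF this] show ?thesis by (rule sym)
qed

lemma crossings_on_remove: "crossings_on (X - {s}) = {c \<in> crossings_on X. s \<notin> \<Union>(fst c)}"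
proof (intro equalityI subsetI)
  fix c assume c: "c \<in> crossings_on (X - {s})"
  then have "c \<in> crossings_on X"
    using crossings_mono complete_edges_mono[of "X - {s}" X] by blast
  moreover have "s \<notin> \<Union>(fst c)"
    using c by (rule crossings_cases) (auto simp: complete_edges_def)
  ultimately show "c \<in> {c \<in> crossings_on X. s \<notin> \<Union>(fst c)}" by blast
next
  fix c assume "c \<in> {c \<in> crossings_on X. s \<notin> \<Union>(fst c)}"
  then have c: "c \<in> crossings_on X" and s: "s \<notin> \<Union>(fst c)" by auto
  from c obtain e f x where c: "c = ({e, f}, x)" and ef: "e \<in> complete_edges X" "f \<in> complete_edges X" "e \<noteq> f"
    and x: "x \<in> edge_interior e" "x \<in> edge_interior f"
    by (rule crossings_cases)
  have "e \<in> complete_edges (X - {s})" "f \<in> complete_edges (X - {s})"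
    using c s ef by (auto simp: complete_edges_def)
  then show "c \<in> crossings_on (X - {s})" unfolding c using ef(3) x by (rule crossingsI)
qed

lemma card_crossings_on_remove: "card (crossings_on X) = card (crossings_on (X - {q})) + card incident"
proof -
  have "crossings_on X = crossings_on (X - {q}) \<union> {c \<in> crossings_on X. q \<in> \<Union>(fst c)}"
    unfolding crossings_on_remove by auto
  moreover have "crossings_on (X - {q}) \<inter> {c \<in> crossings_on X. q \<in> \<Union>(fst c)} = {}"
    unfolding crossings_on_remove by auto
  moreover have "finite (crossings_on (X - {q}))" using finite_crossings_on unfolding crossings_on_remove by simp
  ultimately show ?thesis
    using card_Un_disjoint[of "crossings_on (X - {q})" "{c \<in> crossings_on X. q \<in> \<Union>(fst c)}"] finite_crossings_on
      card_crossings_at by simp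
qed

text \<open>The normal form of \<open>crossing_at_vertex\<close>, taken at each end of one edge,
  shows that neither end lies on the other edge.\<close>

lemma crossing_four_vertices:
  assumes "c \<in> crossings_on X"
  shows "card (\<Union>(fst c)) = 4" "\<Union>(fst c) \<subseteq> X"
proof -
  obtain e f x where c: "c = ({e, f}, x)" and ef: "e \<in> complete_edges X" "f \<in> complete_edges X"
    using assms unfolding crossings_def by blast
  then show "\<Union>(fst c) \<subseteq> X" by (auto simp: complete_edges_def)
  have "card e = 2" using ef by (simp add: complete_edges_def)
  then obtain s where s: "s \<in> e" by fastforce
  then have "s \<in> \<Union>(fst c)" using c by simp
  with assms obtain v F x where c': "c = ({{s, v}, F}, x)" "s \<in> X" "v \<in> X" "v \<noteq> s"
    "F \<in> complete_edges (X - {s})" "x \<in> edge_interior {s, v} \<inter> edge_interior F"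
    by (rule crossing_at_vertex)
  have "v \<in> \<Union>(fst c)" using c' by simp
  with assms obtain s' F' x' where c'': "c = ({{v, s'}, F'}, x')" "F' \<in> complete_edges (X - {v})"
    by (rule crossing_at_vertex)
  have sF: "s \<notin> F" "card F = 2" and vF': "v \<notin> F'" using c'(5) c''(2) by (auto simp: complete_edges_def)
  have "{{s, v}, F} = {{v, s'}, F'}" using c'(1) c''(1) by simp
  then have "F = F' \<or> {s, v} = F'" by (auto simp: doubleton_eq_iff)
  then have "v \<notin> F" using vF' by auto
  have "finite F" using sF(2) card.infinite by fastforce
  have "\<Union>(fst c) = insert s (insert v F)" using c' by auto
  then show "card (\<Union>(fst c)) = 4" using sF \<open>v \<notin> F\<close> \<open>finite F\<close> c'(4) by simp
qed

lemma sum_crossings_at: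
  "(\<Sum>s\<in>X. card {c \<in> crossings_on X. s \<in> \<Union>(fst c)}) = 4 * card (crossings_on X)"
proof (rule sum_multicount[OF fin_X finite_crossings_on], intro ballI)
  fix c assume "c \<in> crossings_on X"
  note f = crossing_four_vertices[OF this]
  have "{s \<in> X. s \<in> \<Union>(fst c)} = \<Union>(fst c)" using f(2) by blast
  then show "card {s \<in> X. s \<in> \<Union>(fst c)} = 4" using f(1) by simp
qed

lemma card_S: "card S = 2 * card P"
proof -
  have "P \<inter> uminus ` P = {}" using no_antipodes by auto
  moreover have "card (uminus ` P) = card P" by (intro card_image) simp
  ultimately show ?thesis using fin by (simp add: S_def card_Un_disjoint)
qed

lemma card_R: "card R = (if q \<in> S then card P - 1 else card P)"
proof (cases "q \<in> S")
  case True
  then have "R = P - {base q}" using no_antipodes by (auto simp: R_def base_def S_def)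
  then show ?thesis using True base_in_P by simp
next
  case False
  then have "- q \<notin> P" using S_uminus[of "- q"] by (auto simp: S_def)
  then have "R = P" using False by (auto simp: R_def S_def)
  then show ?thesis using False by simp
qed

text \<open>With m = \<open>card R\<close>, the binomials add up to m^2 (m - 1) / 2 for q in S and
  to m (m - 1)^2 / 2 otherwise.\<close>

lemma incident_count:
  "real (card incident) = (if q \<in> S then (real (card P) - 1)\<^sup>2 * (real (card P) - 2) / 2
     else real (card P) * (real (card P) - 1)\<^sup>2 / 2)"
proof -
  \<comment> \<open>This form makes the truncated subtractions of natural numbers evaluate
    exactly.\<close>
  obtain m where "card P = m + 3" using card3 by (metis le_add_diff_inverse2)
  then show ?thesis
    by (simp add: card_incident card_R real_choose_two field_simps power2_eq_square)
qed

end

subsection \<open>Counting crossings\<close>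

text \<open>For s in S, inserting s changes nothing and the guard q \<notin> S makes the
  independence condition vacuous.\<close>

lemma antipodal_configuration_if_in:
  assumes "k \<ge> 3" "finite P" "card P = k" "P \<subseteq> sphere 0 1" "general_position P"
    and "\<forall>p\<in>P. half_circle p (h {p, - p})"
    and "\<forall>p\<in>P. h {p, - p} \<inter> (P \<union> uminus ` P) = {p, - p}"
    and "crossings (antipodal_pairs P) h = {}"
    and "s \<in> P \<union> uminus ` P"
  shows "antipodal_configuration P h s"
proof
  show "norm s = 1" using assms(4,9) by auto
  show "w \<notin> h {p, - p}" if "p \<in> P" "w \<in> insert s (P \<union> uminus ` P)" "w \<noteq> p" "w \<noteq> - p" for p w
    using assms(7,9) that by blast
qed (use assms in blast)+

lemma antipodal_configuration_new_point:
  assumes "k \<ge> 3" "finite P" "card P = k" "P \<subseteq> sphere 0 1" "general_position P"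
    and "\<forall>p\<in>P. half_circle p (h {p, - p})"
    and "\<forall>p\<in>P. h {p, - p} \<inter> (P \<union> uminus ` P) = {p, - p}"
    and "crossings (antipodal_pairs P) h = {}"
    and "q \<in> sphere 0 1" "general_position_wrt q (P \<union> uminus ` P)" "\<forall>p\<in>P. q \<notin> h {p, - p}"
  shows "antipodal_configuration P h q"
proof
  show "norm q = 1" using assms(9) by simp
  show "w \<notin> h {p, - p}" if "p \<in> P" "w \<in> insert q (P \<union> uminus ` P)" "w \<noteq> p" "w \<noteq> - p" for p w
    using assms(7,11) that by blast
  show "indep3 q a b" if ab: "a \<in> P" "b \<in> P" "a \<noteq> b" for a b
  proof (rule indep3_if_not_great_circle)
    show "norm q = 1" "norm a = 1" "norm b = 1" using assms(4,9) ab by auto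
    have "b \<noteq> - a"
      using general_position_no_antipodes[of P a] assms(1,3,4,5) ab by auto
    then show "\<not> (\<exists>C. great_circle C \<and> {q, a, b} \<subseteq> C)"
      using assms(10) ab unfolding general_position_wrt_def by blast
  qed
qed (use assms in blast)+

theorem theorem1p1:
  fixes k n :: nat
    and P S :: "(real^3) set"
    and h :: "(real^3) set \<Rightarrow> (real^3) set"
  assumes "k \<ge> 3"
    and "finite P" and "card P = k" and "P \<subseteq> sphere 0 1" and "general_position P"
    and "S = P \<union> uminus ` P" and "n = 2 * k"
    and "\<forall>p\<in>P. half_circle p (h {p, - p})"
    and "\<forall>p\<in>P. h {p, - p} \<inter> S = {p, - p}"
    and "crossings (antipodal_pairs P) h = {}"
  shows "geodesic_drawing_of_complete_graph n S (antipodal_drawing P h) \<and>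
         has_exactly_crossings S (antipodal_drawing P h) (H (int n)) \<and>
         (\<forall>s\<in>S.
            geodesic_drawing_of_complete_graph (n - 1) (S - {s}) (antipodal_drawing P h) \<and>
            has_exactly_crossings (S - {s}) (antipodal_drawing P h) (H (int n - 1))) \<and>
         (\<forall>q\<in>sphere 0 1.
            q \<notin> S \<and> general_position_wrt q S \<and> (\<forall>p\<in>P. q \<notin> h {p, - p}) \<longrightarrow>
            geodesic_drawing_of_complete_graph (n + 1) (insert q S) (antipodal_drawing P h) \<and>
            has_exactly_crossings (insert q S) (antipodal_drawing P h) (H (int n + 1)))"
proof -
  let ?D = "antipodal_drawing P h"
  let ?c = "\<lambda>V. crossings (complete_edges V) ?D"
  note S = assms(6) and avoid = assms(9)[unfolded assms(6)]
  have conf: "antipodal_configuration P h s" if "s \<in> S" for s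
    using antipodal_configuration_if_in[OF assms(1-5,8) avoid assms(10)] that S by blast
  have "P \<noteq> {}" using assms(1,3) by auto
  then obtain s0 where s0: "s0 \<in> S" using S by blast
  \<comment> \<open>An arbitrary vertex serves for the facts about the whole drawing, because
    \<open>insert s0 S\<close> is S.\<close>
  interpret C: antipodal_configuration P h s0 "P \<union> uminus ` P" "insert s0 (P \<union> uminus ` P)" ?D
    by (rule conf[OF s0])
  have ins: "insert s S = S" if "s \<in> S" for s using that by blast
  have cardS: "card S = n" using C.card_S assms by simp
  have finS: "finite S" using C.fin_S S by simp
  \<comment> \<open>The number of crossings at each vertex of S, the same for all of them.\<close>
  define N where "N = (real k - 1)\<^sup>2 * (real k - 2) / 2"
  have at: "real (card {c \<in> ?c S. s \<in> \<Union>(fst c)}) = N"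
    and remove: "real (card (?c S)) = real (card (?c (S - {s}))) + N" if s: "s \<in> S" for s
  proof -
    interpret I: antipodal_configuration P h s "P \<union> uminus ` P" "insert s (P \<union> uminus ` P)" ?D
      by (rule conf[OF s])
    have "real (card I.incident) = N"
      using I.incident_count s S assms(3) by (simp add: N_def)
    then show "real (card {c \<in> ?c S. s \<in> \<Union>(fst c)}) = N"
      "real (card (?c S)) = real (card (?c (S - {s}))) + N"
      using I.card_crossings_at I.card_crossings_on_remove ins[OF s] by (simp_all flip: S)
  qed
  \<comment> \<open>Every crossing is counted at its four endpoints, so the total is n N / 4 = k (k
    - 1)^2 (k - 2) / 4.\<close>
  have "4 * real (card (?c S)) = (\<Sum>s\<in>S. real (card {c \<in> ?c S. s \<in> \<Union>(fst c)}))"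
    using C.sum_crossings_at ins[OF s0] by (simp flip: S of_nat_sum)
  also have "\<dots> = real n * N" using at cardS by simp
  finally have total: "real (card (?c S)) = H (int n)"
    using H_even[of "int k"] assms(7) by (simp add: N_def field_simps)
  have fin: "finite (?c S)" using C.finite_crossings_on ins[OF s0] by (simp flip: S)
  have draw: "geodesic_drawing_of_complete_graph (card V) V ?D" if "V \<subseteq> S" for V
    using C.complete_drawing[of V] that S by blast
  have part1: "geodesic_drawing_of_complete_graph (n - 1) (S - {s}) ?D \<and>
      has_exactly_crossings (S - {s}) ?D (H (int n - 1))" if s: "s \<in> S" for s
  proof
    show "geodesic_drawing_of_complete_graph (n - 1) (S - {s}) ?D"
      using draw[of "S - {s}"] s cardS by auto
    have "finite (?c (S - {s}))"
      by (rule finite_subset[OF crossings_mono[OF complete_edges_mono[OF Diff_subset]] fin])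
    \<comment> \<open>The odd formula is used with j = k - 1; deleting s removes precisely its N
      crossings.\<close>
    moreover have "int n - 1 = 2 * (int k - 1) + 1" using assms by simp
    then have "H (int n - 1) = H (int n) - N"
      using H_odd[of "int k - 1"] H_even[of "int k"] assms(7)
      by (simp add: N_def field_simps power2_eq_square)
    ultimately show "has_exactly_crossings (S - {s}) ?D (H (int n - 1))"
      using remove[OF s] total unfolding has_exactly_crossings_def by simp
  qed
  have part2: "geodesic_drawing_of_complete_graph (n + 1) (insert q S) ?D \<and>
      has_exactly_crossings (insert q S) ?D (H (int n + 1))"
    if q: "q \<in> sphere 0 1" "q \<notin> S" "general_position_wrt q S" "\<forall>p\<in>P. q \<notin> h {p, - p}" for q
  proof
    interpret I: antipodal_configuration P h q "P \<union> uminus ` P" "insert q (P \<union> uminus ` P)" ?D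
      using antipodal_configuration_new_point[OF assms(1-5,8) avoid assms(10) q(1) q(3)[unfolded S] q(4)] .
    show "geodesic_drawing_of_complete_graph (n + 1) (insert q S) ?D"
      using I.complete_drawing[OF order_refl] q(2) finS cardS by (simp flip: S)
    have "real (card I.incident) = real k * (real k - 1)\<^sup>2 / 2"
      using I.incident_count q(2) S assms(3) by simp
    moreover have "card (?c (insert q S)) = card (?c S) + card I.incident"
      using I.card_crossings_on_remove q(2) by (simp flip: S)
    \<comment> \<open>The odd formula with j = k exceeds \<open>H (int n)\<close> by exactly the
      number of crossings at q.\<close>
    moreover have "H (int n + 1) = H (int n) + real k * (real k - 1)\<^sup>2 / 2"
      using H_odd[of "int k"] H_even[of "int k"] assms(7)
      by (simp add: field_simps power2_eq_square)
    ultimately show "has_exactly_crossings (insert q S) ?D (H (int n + 1))"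
      using total I.finite_crossings_on unfolding has_exactly_crossings_def by (simp flip: S)
  qed
  show ?thesis
    using draw[OF order_refl] cardS fin total part1 part2
    unfolding has_exactly_crossings_def by simp
qed

end
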